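(* Let $q\ge 4$ be a prime power. For every run of Algorithm 1 (described in the context) over $\mathbb{F}_q$, the output is a set of vectors $\{\boldsymbol{u}_1^{(1)},\boldsymbol{u}_2^{(1)},\dots,\boldsymbol{u}_1^{(L)},\boldsymbol{u}_2^{(L)}\}\subseteq\mathbb{F}_q^4$ with $$L\geq\max\Big\{\Big\lceil\tfrac{\sqrt2}{3}q\Big\rceil,\,3\Big\}.$$ Moreover, for this $L$ there exists a locally repairable code with disjoint local repair groups and parameters $(n,k,d,r)_q$ with $$n=3L\geq\max\Big\{3\Big\lceil\tfrac{\sqrt2}{3}q\Big\rceil,\,9\Big\},\quad k=2L-4,\quad d\in\{7,8\},\quad r=2,$$ and its dimension satisfies $$k=\frac{2n}{3}-\Big\lceil\log_q\big(q+(q-1)q(n-2)\big)\Big\rceil .$$ In particular, if $n>q+4$, then $d=7$; in this case the code is almost optimal, and it has the best possible minimum distance for its other parameters, i.e. every locally repairable code over $\mathbb{F}_q$ with the same length $n$, the same dimension $k$ and locality $2$ has minimum distance at most $7$.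
   Context: A $q$-ary $[n,k,d]$ linear code $\mathcal{C}\subseteq\mathbb{F}_q^n$ (length $n$, dimension $k$, minimum Hamming distance $d$) is a locally repairable code (LRC) with locality $r$, with parameters denoted $(n,k,d,r)_q$, if for every $i\in[n]=\{1,\dots,n\}$ there are a set $R_i\subseteq[n]\setminus\{i\}$ with $|R_i|\le r$ and fixed nonzero elements $k_j\in\mathbb{F}_q\setminus\{0\}$ ($j\in R_i$) such that $c_i=\sum_{j\in R_i}k_jc_j$ for every codeword $(c_1,\dots,c_n)\in\mathcal{C}$. Such a set $R_i\cup\{i\}$ is called a local repair group. $\mathcal{C}$ has disjoint local repair groups if some local repair groups form a partition of $[n]$ and each of them has cardinality $r+1$. An LRC is almost optimal if $d=n-k-\lceil k/r\rceil+1$. (The displayed equality for $k$ says that the code attains with equality the bound $k\le\frac{rn}{r+1}-\lceil\log_q(q+(q-1)q(\frac r2n-r))\rceil$, valid for LRCs with disjoint local repair groups and $d\ge7$, at $r=2$.) For a nonzero $\mathbb{F}_q$-vector space $V$, let $\left[{V\atop 1}\right]$ denote the set of all one-dimensional subspaces of $V$. A $2$-spread of $\mathbb{F}_q^4$ is a set of two-dimensional subspaces that pairwise intersect in $\{\boldsymbol 0\}$ and whose union is $\mathbb{F}_q^4$; $2$-spreads of $\mathbb{F}_q^4$ exist and have size $q^2+1$. Algorithm 1 (input: $\mathbb{F}_q$ with $q\ge4$). Step 1 (Initialization): Set $i=0$. Take a $2$-spread $\{P_1,\dots,P_{q^2+1}\}$ of $\mathbb{F}_q^4$, and let $\mathcal{M}=\{A_1,\dots,A_{q^2+1}\}$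 where $A_t=\left[{P_t\atop 1}\right]$. Step 2 (Choose): Replace $i$ by $i+1$. Pick an arbitrary set $A\in\mathcal{M}$ and three arbitrary distinct elements of $A$ (each a one-dimensional subspace); choose spanning vectors $\boldsymbol{u}_0^{(i)},\boldsymbol{u}_1^{(i)},\boldsymbol{u}_2^{(i)}$ of these three one-dimensional subspaces such that $\boldsymbol{u}_0^{(i)}=\boldsymbol{u}_1^{(i)}-\boldsymbol{u}_2^{(i)}$. Replace $\mathcal{M}$ by $\mathcal{M}\setminus\{A\}$. Step 3 (Trim): If $i\ge2$ and $\mathcal{M}\ne\varnothing$, then each $B\in\mathcal{M}$ is replaced by $B\setminus\bigcup_{j=1}^{i-1}\bigcup_{a,b\in\{0,1,2\}}\left[{\mathrm{span}\{\boldsymbol{u}_a^{(i)},\boldsymbol{u}_b^{(j)}\}\atop 1}\right]$, and is then deleted from $\mathcal{M}$ if it has fewer than $3$ elements. After that, if $\mathcal{M}\neq\varnothing$ go back to Step 2; if $\mathcal{M}=\varnothing$, set $L=i$, output $\{\boldsymbol{u}_1^{(1)},\boldsymbol{u}_2^{(1)},\dots,\boldsymbol{u}_1^{(L)},\boldsymbol{u}_2^{(L)}\}$ and stop. A run of the algorithm means any sequence of choices (of the $2$-spread, the sets $A$, the three elements and the spanning vectors) permitted by these steps. *)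

theory Defs
  imports
    "HOL-Analysis.Analysis"
    "HOL-Library.Function_Algebras"
    "HOL-Library.Disjoint_Sets"
begin

section \<open>Linear codes of variable length\<close>

text \<open>
  The length of a code is a number computed at run time, so words are functions
  \<^typ>\<open>nat \<Rightarrow> 'a\<close> vanishing outside the coordinate set \<^term>\<open>{1..n::nat}\<close>. Addition of
  words is the pointwise one from Function_Algebras.
\<close>

definition scale_word :: "'a::field \<Rightarrow> (nat \<Rightarrow> 'a) \<Rightarrow> (nat \<Rightarrow> 'a)" where
  "scale_word a x = (\<lambda>i. a * x i)"

global_interpretation word: vector_space scale_word
  by unfold_locales (auto simp: scale_word_def fun_eq_iff algebra_simps)

definition words :: "nat \<Rightarrow> (nat \<Rightarrow> 'a::field) set" where
  "words n = {x. \<forall>i. i \<notin> {1..n} \<longrightarrow> x i = 0}"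

definition hamming_dist :: "nat \<Rightarrow> (nat \<Rightarrow> 'a) \<Rightarrow> (nat \<Rightarrow> 'a) \<Rightarrow> nat" where
  "hamming_dist n x y = card {i \<in> {1..n}. x i \<noteq> y i}"

definition min_dist :: "nat \<Rightarrow> (nat \<Rightarrow> 'a) set \<Rightarrow> nat" where
  "min_dist n C = Min {hamming_dist n x y | x y. x \<in> C \<and> y \<in> C \<and> x \<noteq> y}"

text \<open>The zero code is excluded because it has no minimum distance.\<close>

definition linear_code :: "nat \<Rightarrow> nat \<Rightarrow> nat \<Rightarrow> (nat \<Rightarrow> 'a::{field,finite}) set \<Rightarrow> bool" where
  "linear_code n k d C \<longleftrightarrow>
     C \<subseteq> words n \<and> word.subspace C \<and> C \<noteq> {0} \<and> word.dim C = k \<and> min_dist n C = d"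

section \<open>Local repair\<close>

definition repair_set :: "nat \<Rightarrow> nat \<Rightarrow> (nat \<Rightarrow> 'a::field) set \<Rightarrow> nat \<Rightarrow> nat set \<Rightarrow> bool" where
  "repair_set n r C i R \<longleftrightarrow>
     R \<subseteq> {1..n} - {i} \<and> card R \<le> r \<and>
     (\<exists>\<kappa>. (\<forall>j\<in>R. \<kappa> j \<noteq> 0) \<and> (\<forall>c\<in>C. c i = (\<Sum>j\<in>R. \<kappa> j * c j)))"

definition lrc :: "nat \<Rightarrow> nat \<Rightarrow> nat \<Rightarrow> nat \<Rightarrow> (nat \<Rightarrow> 'a::{field,finite}) set \<Rightarrow> bool" where
  "lrc n k d r C \<longleftrightarrow> linear_code n k d C \<and> (\<forall>i\<in>{1..n}. \<exists>R. repair_set n r C i R)"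

definition repair_group :: "nat \<Rightarrow> nat \<Rightarrow> (nat \<Rightarrow> 'a::field) set \<Rightarrow> nat set \<Rightarrow> bool" where
  "repair_group n r C G \<longleftrightarrow> (\<exists>i\<in>{1..n}. \<exists>R. repair_set n r C i R \<and> G = insert i R)"

definition disjoint_repair_groups :: "nat \<Rightarrow> nat \<Rightarrow> (nat \<Rightarrow> 'a::field) set \<Rightarrow> bool" where
  "disjoint_repair_groups n r C \<longleftrightarrow>
     (\<exists>\<G>. partition_on {1..n} \<G> \<and> (\<forall>G\<in>\<G>. repair_group n r C G \<and> card G = r + 1))"

definition almost_optimal :: "nat \<Rightarrow> nat \<Rightarrow> nat \<Rightarrow> nat \<Rightarrow> bool" where
  "almost_optimal n k d r \<longleftrightarrow> int d = int n - int k - \<lceil>real k / real r\<rceil> + 1"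

section \<open>The algorithm\<close>

definition one_dim_subspaces :: "('a::field ^ 'n) set \<Rightarrow> ('a ^ 'n) set set" where
  "one_dim_subspaces V = {l. l \<subseteq> V \<and> vec.subspace l \<and> vec.dim l = 1}"

definition two_spread :: "('a::field ^ 4) set set \<Rightarrow> bool" where
  "two_spread S \<longleftrightarrow>
     (\<forall>P\<in>S. vec.subspace P \<and> vec.dim P = 2) \<and>
     (\<forall>P\<in>S. \<forall>Q\<in>S. P \<noteq> Q \<longrightarrow> P \<inter> Q = {0}) \<and>
     \<Union>S = UNIV"

text \<open>
  \<open>w 0\<close>, \<open>w 1\<close>, \<open>w 2\<close> span three distinct elements of \<open>A\<close>. If \<open>A\<close> consists of one-dimensional
  subspaces, these vectors are automatically nonzero.
\<close>

definition admissible_choice :: "('a::field ^ 4) set set \<Rightarrow> (nat \<Rightarrow> 'a ^ 4) \<Rightarrow> bool" where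
  "admissible_choice A w \<longleftrightarrow>
     (\<forall>a\<in>{0,1,2}. vec.span {w a} \<in> A) \<and>
     vec.span {w 0} \<noteq> vec.span {w 1} \<and>
     vec.span {w 0} \<noteq> vec.span {w 2} \<and>
     vec.span {w 1} \<noteq> vec.span {w 2} \<and>
     w 0 = w 1 - w 2"

text \<open>In the following, \<open>u i a\<close> is the vector \<open>u\<^sub>a\<close> chosen in round \<open>i\<close>.\<close>

definition removed :: "(nat \<Rightarrow> nat \<Rightarrow> 'a::field ^ 4) \<Rightarrow> nat \<Rightarrow> ('a ^ 4) set set" where
  "removed u i =
     (\<Union>j\<in>{1..i-1}. \<Union>a\<in>{0,1,2}. \<Union>b\<in>{0,1,2}. one_dim_subspaces (vec.span {u i a, u j b}))"

definition trim :: "(nat \<Rightarrow> nat \<Rightarrow> 'a::{field,finite} ^ 4) \<Rightarrow> nat \<Rightarrow> ('a ^ 4) set set set \<Rightarrow>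
    ('a ^ 4) set set set" where
  "trim u i N =
     (if i \<ge> 2 \<and> N \<noteq> {} then {B' \<in> (\<lambda>B. B - removed u i) ` N. card B' \<ge> 3} else N)"

text \<open>
  \<open>M i\<close> is the family after round \<open>i\<close>, and \<open>M 0\<close> the initial one. Rounds are performed exactly
  as long as the family is nonempty; the values of \<open>u\<close> and \<open>M\<close> beyond the last round
  are irrelevant. Termination is not part of this definition.
\<close>

definition algorithm_run :: "(nat \<Rightarrow> nat \<Rightarrow> 'a::{field,finite} ^ 4) \<Rightarrow>
    (nat \<Rightarrow> ('a ^ 4) set set set) \<Rightarrow> bool" where
  "algorithm_run u M \<longleftrightarrow>
     (\<exists>S. two_spread S \<and> M 0 = one_dim_subspaces ` S) \<and>
     (\<forall>i\<ge>1. (\<forall>j<i. M j \<noteq> {}) \<longrightarrow>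
        (\<exists>A\<in>M (i - 1). admissible_choice A (u i) \<and> M i = trim u i (M (i - 1) - {A})))"

definition algorithm_output :: "(nat \<Rightarrow> nat \<Rightarrow> 'a::{field,finite} ^ 4) \<Rightarrow>
    (nat \<Rightarrow> ('a ^ 4) set set set) \<Rightarrow> nat \<Rightarrow> ('a ^ 4) set \<Rightarrow> bool" where
  "algorithm_output u M L U \<longleftrightarrow>
     M L = {} \<and> (\<forall>i<L. M i \<noteq> {}) \<and> U = (\<Union>i\<in>{1..L}. {u i 1, u i 2})"

end

theory Submission
  imports Defs
begin

text \<open>
  Let \<open>u\<close> be the vectors of a run. The code consists of the words with zero sum on each of the \<open>L\<close> triples
  of coordinates and with \<open>\<Sum>\<^sub>i x\<^sub>i\<^sub>1 u\<^sub>i\<^sub>1 + x\<^sub>i\<^sub>2 u\<^sub>i\<^sub>2 = 0\<close>. A triple of weight two contributes a multiple of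
  one \<open>u\<^sub>i\<^sub>a\<close>, so a nonzero word of weight at most six would give a dependence between vectors from at
  most three rounds, which the spread and the trimming step rule out; five vectors of \<open>F\<^sub>q\<^sup>4\<close> from three
  rounds are dependent, which gives a word of weight at most eight. Counting the points lost by the spread
  elements that were never chosen bounds \<open>L\<close> from below, and a sphere-packing argument bounds it
  from above.

  For the last claim, a code with the same parameters and distance at least eight is extremal for
  the Singleton-type bound. Its repair groups can then be chosen disjoint and of size three (unless
  \<open>L = 3\<close>, which is treated directly), and the same packing argument gives \<open>n \<le> q + 4\<close>.
\<close>

section \<open>Counting in finite vector spaces\<close>

text \<open>Dimensions are handled through cardinalities: \<open>CARD('a) ^ e \<le> card K\<close>
  stands for dimension at least \<open>e\<close>, and independence of parity checks becomes
  surjectivity of a syndrome map. Both upper bounds on the length come from one packing inequality,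
  with different sets packed on a distinguished triple. Distance 7 allows a line of \<open>q\<close>
  words there, which gives \<open>q + (q - 1) * q * (n - 2) \<le> q ^ 4\<close>; distance 8 allows
  the whole plane of \<open>q ^ 2\<close> words, which gives \<open>n \<le> q + 4\<close>, the
  threshold of the last claim. For the ceiling of the logarithm to be 4 the same quantity must
  exceed \<open>q ^ 3\<close>; this holds once \<open>n \<ge> q + 4\<close>, which the count of lost
  points provides for \<open>q \<ge> 4\<close>. The competing codes in the last claim come with no
  information on how their repair groups overlap, so disjoint triples have to be extracted before
  packing applies.\<close>

lemma card_kernel_image:
  fixes f :: "'b::ab_group_add \<Rightarrow> 'c::ab_group_add"
  assumes "finite D" and diff: "\<And>x y. x \<in> D \<Longrightarrow> y \<in> D \<Longrightarrow> x - y \<in> D"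
    and add: "\<And>x y. x \<in> D \<Longrightarrow> y \<in> D \<Longrightarrow> x + y \<in> D"
    and f: "\<And>x y. x \<in> D \<Longrightarrow> y \<in> D \<Longrightarrow> f (x + y) = f x + f y"
  shows "card D = card {x \<in> D. f x = 0} * card (f ` D)"
proof -
  have fdiff: "f (x - y) = f x - f y" if "x \<in> D" "y \<in> D" for x y
    using f[OF diff[OF that] that(2)] by (simp add: eq_diff_eq)
  have fiber: "card {x \<in> D. f x = y} = card {x \<in> D. f x = 0}" if "y \<in> f ` D" for y
  proof -
    obtain x0 where x0: "x0 \<in> D" "y = f x0"
      using \<open>y \<in> f ` D\<close> by blast
    have "bij_betw (\<lambda>x. x + x0) {x \<in> D. f x = 0} {x \<in> D. f x = y}"
      by (rule bij_betw_byWitness[where f' = "\<lambda>x. x - x0"])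
        (use x0 in \<open>auto simp: f fdiff intro: add diff\<close>)
    then show ?thesis
      by (simp add: bij_betw_same_card)
  qed
  have "card D = (\<Sum>y\<in>f ` D. card {x \<in> D. f x = y})"
    using sum.image_gen[OF \<open>finite D\<close>, of "\<lambda>_. 1::nat" f] by simp
  then show ?thesis
    using fiber by simp
qed

lemma (in vector_space) card_span:
  assumes "finite B" "independent B" "finite (UNIV :: 'a set)"
  shows "finite (span B) \<and> card (span B) = CARD('a) ^ card B"
  using assms
proof (induction B rule: finite_induct)
  case (insert b B)
  have b: "b \<notin> span B"
    using insert.prems(1) insert.hyps(2) by (simp add: independent_insert)
  have IH: "finite (span B)" "card (span B) = CARD('a) ^ card B"
    using insert independent_mono[of "insert b B" B] by auto
  let ?f = "\<lambda>(k, x). scale k b + x"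
  have "inj_on ?f (UNIV \<times> span B)"
  proof (rule inj_onI, clarsimp)
    fix k x l y
    assume "x \<in> span B" "y \<in> span B" and eq: "scale k b + x = scale l b + y"
    from eq have "scale (k - l) b = y - x"
      by (simp add: algebra_simps)
    with \<open>x \<in> span B\<close> \<open>y \<in> span B\<close> have "scale (k - l) b \<in> span B"
      by (simp add: span_diff)
    then have "k - l = 0"
      using b span_scale[of "scale (k - l) b" B "inverse (k - l)"] by (cases "k - l = 0") auto
    with eq show "k = l \<and> x = y"
      by simp
  qed
  moreover have "?f ` (UNIV \<times> span B) = span (insert b B)"
  proof (intro subset_antisym subsetI)
    fix v assume "v \<in> span (insert b B)"
    then obtain k where "v - scale k b \<in> span B"
      unfolding span_insert by blast
    then show "v \<in> ?f ` (UNIV \<times> span B)"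
      by (intro image_eqI[of _ _ "(k, v - scale k b)"]) auto
  next
    fix v assume "v \<in> ?f ` (UNIV \<times> span B)"
    then obtain k x where "x \<in> span B" "v = scale k b + x"
      by auto
    then show "v \<in> span (insert b B)"
      unfolding span_insert by (auto intro!: exI[of _ k])
  qed
  ultimately have "bij_betw ?f (UNIV \<times> span B) (span (insert b B))"
    by (simp add: bij_betw_def)
  then show ?case
    using IH insert.hyps insert.prems
    by (metis bij_betw_finite bij_betw_same_card card_cartesian_product card_insert_disjoint
        finite_cartesian_product power_Suc)
qed auto

lemma (in vector_space) card_subspace:
  assumes "subspace V" "finite V" "finite (UNIV :: 'a set)"
  shows "card V = CARD('a) ^ dim V"
proof -
  obtain B where B: "B \<subseteq> V" "independent B" "V \<subseteq> span B" "card B = dim V"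
    using basis_exists by blast
  have "span B = V"
    using B assms(1) by (simp add: span_minimal subset_antisym)
  then show ?thesis
    using card_span[of B] B assms finite_subset by metis
qed

lemma CARD_field_ge_2: "CARD('a::{field,finite}) \<ge> 2"
proof -
  have "card {0, 1 :: 'a} \<le> CARD('a)"
    by (rule card_mono) auto
  then show ?thesis by simp
qed

lemma card_subspace_vec:
  fixes V :: "('a::{field,finite} ^ 'n::finite) set"
  assumes "vec.subspace V"
  shows "card V = CARD('a) ^ vec.dim V"
  using vec.card_subspace[OF assms] by simp

text \<open>The index type is left open because not only words are counted this way, but also the
  families of check values, which are indexed by the groups.\<close>

lemma card_words_on:
  assumes "finite A"
  shows "card {x :: 'i \<Rightarrow> 'a::{zero,finite}. \<forall>i. i \<notin> A \<longrightarrow> x i = 0} = CARD('a) ^ card A"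
    and "finite {x :: 'i \<Rightarrow> 'a. \<forall>i. i \<notin> A \<longrightarrow> x i = 0}"
proof -
  have *: "bij_betw (\<lambda>x. restrict x A) {x :: 'i \<Rightarrow> 'a. \<forall>i. i \<notin> A \<longrightarrow> x i = 0} (A \<rightarrow>\<^sub>E UNIV)"
    by (rule bij_betw_byWitness[where f' = "\<lambda>x i. if i \<in> A then x i else 0"])
      (auto simp: fun_eq_iff PiE_def extensional_def)
  show "card {x :: 'i \<Rightarrow> 'a. \<forall>i. i \<notin> A \<longrightarrow> x i = 0} = CARD('a) ^ card A"
    using bij_betw_same_card[OF *] card_funcsetE[OF assms, of "UNIV :: 'a set"] by simp
  have "finite (A \<rightarrow>\<^sub>E (UNIV :: 'a set))"
    using assms by (simp add: finite_PiE)
  with * show "finite {x :: 'i \<Rightarrow> 'a. \<forall>i. i \<notin> A \<longrightarrow> x i = 0}"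
    by (simp add: bij_betw_finite)
qed

section \<open>Linear codes\<close>

definition weight :: "nat \<Rightarrow> (nat \<Rightarrow> 'a::zero) \<Rightarrow> nat" where
  "weight n x = card {i \<in> {1..n}. x i \<noteq> 0}"

lemma finite_words: "finite (words n :: (nat \<Rightarrow> 'a::{field,finite}) set)"
  unfolding words_def by (rule card_words_on(2)) simp

lemma weight_le_card:
  assumes "finite T" "\<And>i. i \<in> {1..n} \<Longrightarrow> i \<notin> T \<Longrightarrow> x i = 0"
  shows "weight n x \<le> card T"
  unfolding weight_def by (rule card_mono) (use assms in auto)

lemma hamming_dist_eq_weight: "hamming_dist n x y = weight n (x - y :: nat \<Rightarrow> 'a::ab_group_add)"
  by (simp add: hamming_dist_def weight_def)

lemma min_dist_eq:
  fixes C :: "(nat \<Rightarrow> 'a::{field,finite}) set"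
  assumes "C \<subseteq> words n" "word.subspace C"
  shows "min_dist n C = Min (weight n ` (C - {0}))"
proof -
  have "{hamming_dist n x y | x y. x \<in> C \<and> y \<in> C \<and> x \<noteq> y} = weight n ` (C - {0})"
  proof safe
    fix x y assume "x \<in> C" "y \<in> C" "x \<noteq> y"
    then show "hamming_dist n x y \<in> weight n ` (C - {0})"
      using word.subspace_diff[OF assms(2)] by (auto simp: hamming_dist_eq_weight)
  next
    fix x assume "x \<in> C" "x \<noteq> 0"
    then show "\<exists>x' y. weight n x = hamming_dist n x' y \<and> x' \<in> C \<and> y \<in> C \<and> x' \<noteq> y"
      using word.subspace_0[OF assms(2)]
      by (intro exI[of _ x] exI[of _ 0]) (simp add: hamming_dist_eq_weight)
  qed
  then show ?thesis
    by (simp add: min_dist_def)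
qed

lemma min_dist_le_weight:
  fixes C :: "(nat \<Rightarrow> 'a::{field,finite}) set"
  assumes "C \<subseteq> words n" "word.subspace C" "x \<in> C" "x \<noteq> 0"
  shows "min_dist n C \<le> weight n x"
  using assms finite_subset[OF assms(1) finite_words] by (simp add: min_dist_eq)

lemma min_dist_geI:
  fixes C :: "(nat \<Rightarrow> 'a::{field,finite}) set"
  assumes "C \<subseteq> words n" "word.subspace C" "C \<noteq> {0}"
    and "\<And>x. x \<in> C \<Longrightarrow> x \<noteq> 0 \<Longrightarrow> d \<le> weight n x"
  shows "d \<le> min_dist n C"
proof -
  have "C - {0} \<noteq> {}"
    using assms(3) word.subspace_0[OF assms(2)] by auto
  then show ?thesis
    using assms finite_subset[OF assms(1) finite_words] by (simp add: min_dist_eq)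
qed

lemma card_linear_code:
  fixes C :: "(nat \<Rightarrow> 'a::{field,finite}) set"
  assumes "C \<subseteq> words n" "word.subspace C"
  shows "card C = CARD('a) ^ word.dim C"
  using word.card_subspace[OF assms(2) finite_subset[OF assms(1) finite_words]] by simp

text \<open>Singleton bound for a code living outside \<open>S\<close>: deleting
  \<open>d - 1\<close> further coordinates keeps distinct words distinct. The first conjunct, that a
  nonzero word must fit outside \<open>S\<close>, guarantees that the subtractions in the exponent
  are not truncated.\<close>

lemma card_shortened_le:
  fixes K :: "(nat \<Rightarrow> 'a::{field,finite}) set"
  assumes K: "K \<subseteq> words n" "word.subspace K" "K \<noteq> {0}"
    and van: "\<And>x i. x \<in> K \<Longrightarrow> i \<in> S \<Longrightarrow> x i = 0"
    and S: "S \<subseteq> {1..n}" and "1 \<le> d"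
    and wt: "\<And>x. x \<in> K \<Longrightarrow> x \<noteq> 0 \<Longrightarrow> d \<le> weight n x"
  shows "card S + d \<le> n \<and> card K \<le> CARD('a) ^ (n - card S - (d - 1))"
proof -
  obtain x where x: "x \<in> K" "x \<noteq> 0"
    using K word.subspace_0[OF K(2)] by blast
  have cS: "card ({1..n} - S) = n - card S"
    using S by (simp add: card_Diff_subset finite_subset)
  have "card S \<le> n"
    using card_mono[OF _ S] by simp
  moreover have "weight n x \<le> card ({1..n} - S)"
    by (rule weight_le_card) (use van x in auto)
  ultimately have nd: "card S + d \<le> n"
    using wt[OF x] cS by simp
  then have "d - 1 \<le> card ({1..n} - S)"
    using cS by linarith
  then obtain T where T: "T \<subseteq> {1..n} - S" "card T = d - 1"
    using obtain_subset_with_card_n by metis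
  define A where "A = {1..n} - S - T"
  have finT: "finite T" using T finite_subset by blast
  have finA: "finite A"
    by (simp add: A_def)
  have cA: "card A = n - card S - (d - 1)"
    unfolding A_def using T finT cS by (simp add: card_Diff_subset)
  let ?f = "\<lambda>x i. if i \<in> A then x i else 0"
  have "inj_on ?f K"
  proof (rule inj_onI, rule ccontr)
    fix x y assume xy: "x \<in> K" "y \<in> K" "?f x = ?f y" "x \<noteq> y"
    have "x - y \<in> K"
      using word.subspace_diff[OF K(2)] xy by blast
    have "weight n (x - y) \<le> card T"
    proof (rule weight_le_card[OF finT])
      fix i assume i: "i \<in> {1..n}" "i \<notin> T"
      show "(x - y) i = 0"
        using xy i van[OF \<open>x - y \<in> K\<close>] fun_cong[OF xy(3), of i] by (cases "i \<in> S") (auto simp: A_def)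
    qed
    then show False
      using wt[OF \<open>x - y \<in> K\<close>] xy T \<open>1 \<le> d\<close> by auto
  qed
  then have "card K \<le> card {x :: nat \<Rightarrow> 'a. \<forall>i. i \<notin> A \<longrightarrow> x i = 0}"
    by (rule card_inj_on_le) (auto intro: card_words_on(2)[OF finA])
  then show ?thesis
    using nd cA by (simp add: card_words_on(1)[OF finA])
qed

section \<open>Words with one parity check per group\<close>

text \<open>One coefficient function \<open>h\<close> serves all groups, since in a partition each
  coordinate occurs in exactly one check. This is the largest code with the given local checks; it
  is the ambient space of the packing argument.\<close>

definition parity_words :: "nat set \<Rightarrow> nat set set \<Rightarrow> (nat \<Rightarrow> 'a::field) \<Rightarrow> (nat \<Rightarrow> 'a) set" where
  "parity_words A \<G> h =
     {x. (\<forall>i. i \<notin> A \<longrightarrow> x i = 0) \<and> (\<forall>G\<in>\<G>. (\<Sum>j\<in>G. h j * x j) = 0)}"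

lemma subspace_parity_words: "word.subspace (parity_words A \<G> h)"
proof -
  have scale: "(\<Sum>j\<in>G. h j * (c * x j)) = c * (\<Sum>j\<in>G. h j * x j)" for G c and x :: "nat \<Rightarrow> 'a"
    unfolding sum_distrib_left by (rule sum.cong) auto
  show ?thesis
  proof (rule word.subspaceI)
    fix x y :: "nat \<Rightarrow> 'a" assume "x \<in> parity_words A \<G> h" "y \<in> parity_words A \<G> h"
    then show "x + y \<in> parity_words A \<G> h"
      by (simp add: parity_words_def distrib_left sum.distrib)
  next
    fix c and x :: "nat \<Rightarrow> 'a" assume "x \<in> parity_words A \<G> h"
    then show "scale_word c x \<in> parity_words A \<G> h"
      by (simp add: parity_words_def scale_word_def scale)
  qed (simp add: parity_words_def)
qed

lemma finite_parity_words:
  assumes "finite A"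
  shows "finite (parity_words A \<G> h :: (nat \<Rightarrow> 'a::{field,finite}) set)"
  by (rule finite_subset[OF _ card_words_on(2)[OF assms]]) (auto simp: parity_words_def)

lemma partition_on_unique:
  assumes "partition_on A \<G>" "G \<in> \<G>" "H \<in> \<G>" "i \<in> G" "i \<in> H"
  shows "G = H"
  using assms by (auto simp: partition_on_def disjoint_def)

text \<open>Disjoint nonempty groups with nonzero coefficients give independent checks: the map to
  the check values is onto, and \<open>parity_words\<close> is its kernel.\<close>

lemma card_parity_words:
  fixes h :: "nat \<Rightarrow> 'a::{field,finite}"
  assumes fin: "finite A" and part: "partition_on A \<G>" and h: "\<And>i. i \<in> A \<Longrightarrow> h i \<noteq> 0"
  shows "card (parity_words A \<G> h) * CARD('a) ^ card \<G> = CARD('a) ^ card A"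
proof -
  define D where "D = {x :: nat \<Rightarrow> 'a. \<forall>i. i \<notin> A \<longrightarrow> x i = 0}"
  define f where "f = (\<lambda>x :: nat \<Rightarrow> 'a. \<lambda>G. if G \<in> \<G> then (\<Sum>j\<in>G. h j * x j) else 0)"
  have sub: "G \<subseteq> A" if "G \<in> \<G>" for G
    using part that by (auto simp: partition_on_def)
  have fin\<G>: "finite \<G>"
    using finite_elements[OF fin part] .
  have ker: "{x \<in> D. f x = 0} = parity_words A \<G> h"
    by (auto simp: D_def f_def parity_words_def fun_eq_iff)
  have "f ` D = {y. \<forall>G. G \<notin> \<G> \<longrightarrow> y G = 0}"
  proof (intro subset_antisym subsetI)
    fix y :: "nat set \<Rightarrow> 'a" assume "y \<in> {y. \<forall>G. G \<notin> \<G> \<longrightarrow> y G = 0}"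
    then have y: "y G = 0" if "G \<notin> \<G>" for G
      using that by simp
    have "\<exists>i. i \<in> G" if "G \<in> \<G>" for G
      using partition_onD3[OF part] that by (cases "G = {}") auto
    then obtain r where r: "\<And>G. G \<in> \<G> \<Longrightarrow> r G \<in> G"
      by metis
    \<comment> \<open>A preimage of \<open>y\<close> concentrates the value of each group on one
      representative \<open>r G\<close>.\<close>
    define x where "x = (\<lambda>i. \<Sum>G\<in>\<G>. if i = r G then y G / h i else 0)"
    have x: "x j = (if j = r G then y G / h j else 0)" if "G \<in> \<G>" "j \<in> G" for G j
    proof -
      have "x j = (\<Sum>H\<in>\<G>. if H = G then (if j = r G then y G / h j else 0) else 0)"
        unfolding x_def
      proof (rule sum.cong)
        fix H assume "H \<in> \<G>"
        then have "j \<noteq> r H" if "H \<noteq> G"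
          using partition_on_unique[OF part \<open>H \<in> \<G>\<close> \<open>G \<in> \<G>\<close>, of j] r[of H] \<open>j \<in> G\<close> that by blast
        then show "(if j = r H then y H / h j else 0) = (if H = G then (if j = r G then y G / h j else 0) else 0)"
          by (cases "H = G") simp_all
      qed simp
      then show ?thesis
        using that fin\<G> by simp
    qed
    have "(\<Sum>j\<in>G. h j * x j) = y G" if "G \<in> \<G>" for G
    proof -
      have "(\<Sum>j\<in>G. h j * x j) = (\<Sum>j\<in>G. if j = r G then y G else 0)"
      proof (rule sum.cong)
        fix j assume "j \<in> G"
        then show "h j * x j = (if j = r G then y G else 0)"
          using x[OF that \<open>j \<in> G\<close>] h[of j] sub[OF that] by auto
      qed simp
      also have "\<dots> = y G"
        using r[OF that] finite_subset[OF sub[OF that] fin] by simp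
      finally show ?thesis .
    qed
    then have "y G = f x G" for G
      by (cases "G \<in> \<G>") (simp_all add: f_def y)
    then have "y = f x"
      by (rule ext)
    moreover have "x \<in> D"
    proof -
      have "x i = 0" if "i \<notin> A" for i
        unfolding x_def
      proof (rule sum.neutral, rule ballI)
        fix G assume "G \<in> \<G>"
        then have "i \<noteq> r G"
          using that r sub by blast
        then show "(if i = r G then y G / h i else 0) = 0"
          by simp
      qed
      then show ?thesis
        by (simp add: D_def)
    qed
    ultimately show "y \<in> f ` D"
      by blast
  qed (auto simp: f_def)
  then have "card (f ` D) = CARD('a) ^ card \<G>"
    by (simp add: card_words_on(1)[OF fin\<G>])
  moreover have "card D = card {x \<in> D. f x = 0} * card (f ` D)"
    by (rule card_kernel_image)
      (use card_words_on(2)[OF fin] in \<open>auto simp: D_def f_def fun_eq_iff distrib_left sum.distrib\<close>)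
  moreover have "card D = CARD('a) ^ card A"
    using card_words_on(1)[OF fin] by (simp add: D_def)
  ultimately show ?thesis
    by (simp add: ker)
qed

lemma card_parity_words_one:
  fixes h :: "nat \<Rightarrow> 'a::{field,finite}"
  assumes "card G = 3" and h: "\<And>i. i \<in> G \<Longrightarrow> h i \<noteq> 0"
  shows "card (parity_words G {G} h) = CARD('a)\<^sup>2"
proof -
  have "finite G"
    using assms(1) card.infinite by fastforce
  then have "card (parity_words G {G} h) * CARD('a) ^ card {G} = CARD('a) ^ card G"
    by (rule card_parity_words) (use assms in \<open>auto simp: partition_on_def disjoint_def\<close>)
  then have "card (parity_words G {G} h) * CARD('a) = CARD('a)\<^sup>2 * CARD('a)"
    using assms(1) by (simp add: power2_eq_square power3_eq_cube)
  then show ?thesis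
    using CARD_field_ge_2[where 'a='a] by simp
qed

text \<open>Two coordinates of a triple carry, up to a scalar, exactly one word satisfying the
  check. The omitted coordinate \<open>a\<close> serves as the label of this word, so the weight-two
  words of a triple are indexed by its three elements.\<close>

lemma parity_word_in_block:
  fixes h :: "nat \<Rightarrow> 'a::field"
  assumes part: "partition_on A \<G>" and h: "\<And>i. i \<in> A \<Longrightarrow> h i \<noteq> 0"
    and G: "G \<in> \<G>" "a \<in> G" "card G = 3"
  shows "\<exists>w\<in>parity_words A \<G> h. {i. w i \<noteq> 0} = G - {a}"
proof -
  have "card (G - {a}) = 2"
    using G by simp
  then obtain b c where bc: "G - {a} = {b, c}" "b \<noteq> c"
    by (auto simp: card_2_iff)
  have A: "b \<in> A" "c \<in> A" "b \<in> G" "c \<in> G"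
    using bc G part by (auto simp: partition_on_def)
  define w where "w = (\<lambda>i. if i = b then inverse (h b) else if i = c then - inverse (h c) else 0)"
  have sum0: "(\<Sum>j\<in>H. h j * w j) = 0" if "H \<in> \<G>" for H
  proof (cases "H = G")
    case True
    have "finite G"
      using G(3) card.infinite by fastforce
    then have "(\<Sum>j\<in>G. h j * w j) = (\<Sum>j\<in>{b, c}. h j * w j)"
      by (intro sum.mono_neutral_right) (use A in \<open>auto simp: w_def\<close>)
    then show ?thesis
      using bc(2) h A True by (auto simp: w_def)
  next
    case False
    then have "b \<notin> H" "c \<notin> H"
      using partition_on_unique[OF part that G(1)] A by auto
    then show ?thesis
      by (intro sum.neutral) (auto simp: w_def)
  qed
  have "w \<in> parity_words A \<G> h"
    using sum0 A by (auto simp: parity_words_def w_def)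
  moreover have "{i. w i \<noteq> 0} = G - {a}"
    using h A bc by (auto simp: w_def)
  ultimately show ?thesis
    by blast
qed

lemma parity_word_one_group:
  assumes part: "partition_on A \<G>" and G: "G \<in> \<G>"
    and x: "x \<in> parity_words G {G} h"
  shows "x \<in> parity_words A \<G> h"
proof -
  have "(\<Sum>j\<in>H. h j * x j) = 0" if "H \<in> \<G>" for H
  proof (cases "H = G")
    case False
    then have "j \<notin> G" if "j \<in> H" for j
      using partition_on_unique[OF part G \<open>H \<in> \<G>\<close>] that by blast
    then show ?thesis
      using x by (intro sum.neutral) (auto simp: parity_words_def)
  qed (use x in \<open>auto simp: parity_words_def\<close>)
  then show ?thesis
    using x G part by (auto simp: parity_words_def partition_on_def)
qed

section \<open>Packing cosets of a code into the words with local checks\<close>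

text \<open>The translates of \<open>C\<close> by the elements of \<open>W\<close> are pairwise
  disjoint and stay inside \<open>D\<close>.\<close>

lemma card_packing:
  fixes C :: "(nat \<Rightarrow> 'a::field) set"
  assumes "finite D" "word.subspace D" "word.subspace C" "C \<subseteq> D" "W \<subseteq> D"
    and W: "\<And>v w. v \<in> W \<Longrightarrow> w \<in> W \<Longrightarrow> v - w \<in> C \<Longrightarrow> v = w"
  shows "card C * card W \<le> card D"
proof -
  have "inj_on (\<lambda>(c, w). c + w) (C \<times> W)"
  proof (rule inj_onI, clarify)
    fix c v c' w assume "c \<in> C" "c' \<in> C" "v \<in> W" "w \<in> W" and eq: "c + v = c' + w"
    then have "v - w = c' - c"
      by (simp add: algebra_simps)
    then have "v - w \<in> C"
      using word.subspace_diff[OF assms(3) \<open>c' \<in> C\<close> \<open>c \<in> C\<close>] by simp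
    then have "v = w"
      by (rule W[OF \<open>v \<in> W\<close> \<open>w \<in> W\<close>])
    with eq show "c = c' \<and> v = w"
      by simp
  qed
  moreover have "(\<lambda>(c, w). c + w) ` (C \<times> W) \<subseteq> D"
    using assms(4,5) by (auto intro!: word.subspace_add[OF assms(2)])
  ultimately have "card (C \<times> W) \<le> card D"
    using card_inj_on_le assms(1) by blast
  then show ?thesis
    by (simp add: card_cartesian_product)
qed

text \<open>
  The parity checks outside \<open>h\<close> map the words of weight two in a group to the three points of that
  group. The bound says that the points of the groups other than \<open>G0\<close> stay distinct in the
  projection from the image of \<open>Z\<close>.
\<close>

lemma packing_bound:
  fixes C :: "(nat \<Rightarrow> 'a::{field,finite}) set"
  assumes part: "partition_on {1..n} \<G>" and card3: "\<And>G. G \<in> \<G> \<Longrightarrow> card G = 3"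
    and h: "\<And>i. i \<in> {1..n} \<Longrightarrow> h i \<noteq> 0"
    and C: "word.subspace C" "C \<subseteq> parity_words {1..n} \<G> h"
    and wt: "\<And>c. c \<in> C \<Longrightarrow> c \<noteq> 0 \<Longrightarrow> d \<le> weight n c" and d: "6 \<le> d"
    and G0: "G0 \<in> \<G>" and Z: "Z \<subseteq> parity_words G0 {G0} h"
    and Z_diff: "\<And>y z. y \<in> Z \<Longrightarrow> z \<in> Z \<Longrightarrow> \<exists>T. card T + 4 < d \<and> finite T \<and> {i. (y - z) i \<noteq> 0} \<subseteq> T"
  shows "card C * ((n - 3) * (CARD('a) - 1) * card Z + CARD('a)\<^sup>2) \<le> card (parity_words {1..n} \<G> h)"
proof -
  let ?q = "CARD('a)"
  define D where "D = parity_words {1..n} \<G> h"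
  define Y where "Y = parity_words G0 {G0} h"
  define A where "A = {1..n} - G0"
  have G0_sub: "G0 \<subseteq> {1..n}"
    using part G0 by (auto simp: partition_on_def)
  have finG0: "finite G0" and cG0: "card G0 = 3"
    using card3[OF G0] card.infinite by fastforce+
  have YD: "Y \<subseteq> D"
    using parity_word_one_group[OF part G0] by (auto simp: Y_def D_def)
  have ZY: "Z \<subseteq> Y"
    using Z by (simp add: Y_def)
  have Y0: "y i = 0" if "y \<in> Y" "i \<notin> G0" for y i
    using that by (auto simp: Y_def parity_words_def)
  have cY: "card Y = ?q\<^sup>2"
    unfolding Y_def by (rule card_parity_words_one) (use cG0 h G0_sub in auto)
  have finY: "finite Y"
    unfolding Y_def by (rule finite_parity_words[OF finG0])
  have finZ: "finite Z"
    using finite_subset[OF ZY finY] .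
  have "\<forall>a\<in>A. \<exists>G w. G \<in> \<G> \<and> a \<in> G \<and> w \<in> D \<and> {i. w i \<noteq> 0} = G - {a}"
  proof
    fix a assume "a \<in> A"
    then have "a \<in> \<Union>\<G>"
      using partition_onD1[OF part] by (auto simp: A_def)
    then obtain G where G: "G \<in> \<G>" "a \<in> G"
      by blast
    then show "\<exists>G w. G \<in> \<G> \<and> a \<in> G \<and> w \<in> D \<and> {i. w i \<noteq> 0} = G - {a}"
      using parity_word_in_block[of "{1..n}" \<G> h, OF part h G card3[OF G(1)]] G
      unfolding D_def by blast
  qed
  then obtain G w where Gw: "\<And>a. a \<in> A \<Longrightarrow> G a \<in> \<G>" "\<And>a. a \<in> A \<Longrightarrow> a \<in> G a"
    "\<And>a. a \<in> A \<Longrightarrow> w a \<in> D" "\<And>a. a \<in> A \<Longrightarrow> {i. w a i \<noteq> 0} = G a - {a}"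
    by metis
  have disj: "G a \<inter> G0 = {}" if "a \<in> A" for a
    using partition_on_unique[OF part Gw(1)[OF that] G0] Gw(2)[OF that] that by (auto simp: A_def)
  have finG: "finite (G a)" "card (G a) = 3" if "a \<in> A" for a
    using card3[OF Gw(1)[OF that]] card.infinite by fastforce+
  \<comment> \<open>The packed words: a nonzero multiple of a weight-two word outside
    \<open>G0\<close> plus a word of \<open>Z\<close> on \<open>G0\<close>. All words of
    \<open>Y\<close>, supported on \<open>G0\<close>, are packed in addition and account for the
    summand \<open>q ^ 2\<close>.\<close>
  define val where "val = (\<lambda>(a, \<alpha>, z). scale_word \<alpha> (w a) + z)"
  define I where "I = A \<times> (UNIV - {0 :: 'a}) \<times> Z"
  have val_out: "val (a, \<alpha>, z) i = \<alpha> * w a i" if "i \<notin> G0" "z \<in> Z" for a \<alpha> z i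
    using that Y0 ZY by (auto simp: val_def scale_word_def)
  have w0: "w a i = 0" if "a \<in> A" "i \<notin> G a" for a i
    using Gw(4)[OF that(1)] that(2) by auto
  have val_in: "val (a, \<alpha>, z) i = z i" if "a \<in> A" "i \<in> G0" for a \<alpha> z i
    using that w0[OF that(1)] disj[OF that(1)] by (auto simp: val_def scale_word_def)
  have inj: "inj_on val I"
  proof (rule inj_onI)
    fix p p' assume p: "p \<in> I" "p' \<in> I" "val p = val p'"
    obtain a \<alpha> z where pa: "p = (a, \<alpha>, z)" and a: "a \<in> A" "\<alpha> \<noteq> 0" "z \<in> Z"
      using p(1) by (auto simp: I_def)
    obtain b \<beta> y where pb: "p' = (b, \<beta>, y)" and b: "b \<in> A" "\<beta> \<noteq> 0" "y \<in> Z"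
      using p(2) by (auto simp: I_def)
    have eq: "val (a, \<alpha>, z) = val (b, \<beta>, y)"
      using p(3) pa pb by simp
    have eq_out: "\<alpha> * w a i = \<beta> * w b i" for i
    proof (cases "i \<in> G0")
      case True
      then have "i \<notin> G a" "i \<notin> G b"
        using disj[OF a(1)] disj[OF b(1)] by blast+
      then show ?thesis
        using w0[OF a(1)] w0[OF b(1)] by simp
    next
      case False
      then show ?thesis
        using val_out[OF False a(3), of a \<alpha>] val_out[OF False b(3), of b \<beta>] eq by simp
    qed
    have "z i = y i" for i
    proof (cases "i \<in> G0")
      case True
      then show ?thesis
        using val_in[OF a(1) True, of \<alpha> z] val_in[OF b(1) True, of \<beta> y] eq by simp
    next
      case False
      then show ?thesis
        using Y0[of z i] Y0[of y i] a(3) b(3) ZY by (simp add: subset_iff)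
    qed
    then have zy: "z = y"
      by auto
    \<comment> \<open>The scalar is invisible in the support; the support determines the group, and
      then \<open>a\<close> as the element of the group that is missing from it.\<close>
    have "{i. w a i \<noteq> 0} = {i. w b i \<noteq> 0}"
      using eq_out a(2) b(2) by (metis mult_eq_0_iff)
    then have supp: "G a - {a} = G b - {b}"
      using Gw(4) a b by simp
    have "card (G a - {a}) = 2"
      using finG[OF a(1)] Gw(2)[OF a(1)] by simp
    then have "G a - {a} \<noteq> {}"
      by (metis card.empty zero_neq_numeral)
    then obtain i where i: "i \<in> G a - {a}"
      by blast
    have "G a = G b"
      using partition_on_unique[OF part Gw(1)[OF a(1)] Gw(1)[OF b(1)], of i] i supp by blast
    then have ab: "a = b"
      using supp Gw(2)[OF a(1)] Gw(2)[OF b(1)] by blast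
    have "w a i \<noteq> 0"
      using Gw(4)[OF a(1)] i by blast
    then have "\<alpha> = \<beta>"
      using eq_out[of i] ab by simp
    with zy ab show "p = p'"
      by (simp add: pa pb)
  qed
  have disjW: "val ` I \<inter> Y = {}"
  proof (rule ccontr)
    assume "val ` I \<inter> Y \<noteq> {}"
    then obtain p where p: "p \<in> I" "val p \<in> Y"
      by blast
    then obtain a \<alpha> z where a: "a \<in> A" "\<alpha> \<noteq> 0" "z \<in> Z" "val (a, \<alpha>, z) \<in> Y"
      by (auto simp: I_def)
    have "card (G a - {a}) = 2"
      using finG[OF a(1)] Gw(2)[OF a(1)] by simp
    then have "G a - {a} \<noteq> {}"
      by (metis card.empty zero_neq_numeral)
    then obtain i where i: "i \<in> G a - {a}"
      by blast
    have "i \<notin> G0" "w a i \<noteq> 0"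
      using disj[OF a(1)] i Gw(4)[OF a(1)] by blast+
    then show False
      using val_out[of i z a \<alpha>] Y0[OF a(4), of i] a(2,3) by simp
  qed
  have cA: "card A = n - 3"
    using G0_sub finG0 cG0 by (simp add: A_def card_Diff_subset)
  have finI: "finite I"
    using finZ by (simp add: I_def A_def)
  have "card (val ` I) = (n - 3) * ((?q - 1) * card Z)"
    using card_image[OF inj] cA by (simp add: I_def card_cartesian_product card_Diff_subset)
  then have cW: "card (val ` I \<union> Y) = (n - 3) * (?q - 1) * card Z + ?q\<^sup>2"
    using disjW finY cY finI by (simp add: card_Un_disjoint)
  have subD: "word.subspace D"
    unfolding D_def by (rule subspace_parity_words)
  have valD: "val ` I \<subseteq> D"
  proof clarify
    fix a \<alpha> z assume "(a, \<alpha>, z) \<in> I"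
    then have "w a \<in> D" "z \<in> D"
      using Gw(3) YD ZY by (auto simp: I_def)
    then show "val (a, \<alpha>, z) \<in> D"
      by (simp add: val_def word.subspace_add[OF subD] word.subspace_scale[OF subD])
  qed
  have short: "v = v'" if "v - v' \<in> C" "finite T" "card T < d" "{i. (v - v') i \<noteq> 0} \<subseteq> T" for v v' T
  proof (rule ccontr)
    assume "v \<noteq> v'"
    then have "d \<le> weight n (v - v')"
      using wt that by simp
    also have "\<dots> \<le> card T"
      using that by (intro weight_le_card) auto
    finally show False
      using that by simp
  qed
  have valE: "\<exists>a \<alpha> z. a \<in> A \<and> z \<in> Z \<and> v = val (a, \<alpha>, z)" if "v \<in> val ` I" for v
    using that by (auto simp: I_def)
  have supp2: "card (G a - {a}) = 2" "finite (G a - {a})" if "a \<in> A" for a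
    using finG[OF that] Gw(2)[OF that] by auto
  \<comment> \<open>Two words from the image of \<open>I\<close> differ in at most
    \<open>card T + 4\<close> places, a word of this image and a word of \<open>Y\<close> in at most
    \<open>2 + 3\<close> places (hence \<open>6 \<le> d\<close>), and two words of \<open>Y\<close>
    in at most 3.\<close>
  have close: "v = v'" if v: "v \<in> val ` I \<union> Y" and v': "v' \<in> val ` I \<union> Y" and "v - v' \<in> C" for v v'
  proof -
    have mixed: "v = v'" if v1: "v \<in> val ` I" and v2: "v' \<in> Y" and diff: "v - v' \<in> C" for v v'
    proof -
      obtain a \<alpha> z where a: "a \<in> A" "z \<in> Z" "v = val (a, \<alpha>, z)"
        using valE[OF v1] by blast
      show ?thesis
      proof (rule short[OF diff, of "G0 \<union> (G a - {a})"])
        show "card (G0 \<union> (G a - {a})) < d"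
          using card_Un_le[of G0 "G a - {a}"] supp2[OF a(1)] cG0 d by linarith
        show "{i. (v - v') i \<noteq> 0} \<subseteq> G0 \<union> (G a - {a})"
        proof (rule subsetI, rule ccontr)
          fix i assume i: "i \<in> {i. (v - v') i \<noteq> 0}" "i \<notin> G0 \<union> (G a - {a})"
          then have "w a i = 0"
            using Gw(4)[OF a(1)] by blast
          then show False
            using i val_out[of i z a \<alpha>] Y0[OF v2, of i] a by simp
        qed
      qed (use finG0 supp2 a in auto)
    qed
    consider "v \<in> val ` I" "v' \<in> val ` I" | "v \<in> val ` I" "v' \<in> Y" | "v \<in> Y" "v' \<in> val ` I" | "v \<in> Y" "v' \<in> Y"
      using v v' by blast
    then show ?thesis
    proof cases
      case 1
      then obtain a \<alpha> z b \<beta> y where a: "a \<in> A" "z \<in> Z" "v = val (a, \<alpha>, z)"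
        and b: "b \<in> A" "y \<in> Z" "v' = val (b, \<beta>, y)"
        using valE by metis
      obtain T where T: "card T + 4 < d" "finite T" "{i. (z - y) i \<noteq> 0} \<subseteq> T"
        using Z_diff a b by blast
      show ?thesis
      proof (rule short[OF \<open>v - v' \<in> C\<close>, of "T \<union> ((G a - {a}) \<union> (G b - {b}))"])
        show "card (T \<union> ((G a - {a}) \<union> (G b - {b}))) < d"
          using card_Un_le[of T "(G a - {a}) \<union> (G b - {b})"] card_Un_le[of "G a - {a}" "G b - {b}"]
            supp2[OF a(1)] supp2[OF b(1)] T by linarith
        show "{i. (v - v') i \<noteq> 0} \<subseteq> T \<union> ((G a - {a}) \<union> (G b - {b}))"
          unfolding Gw(4)[OF a(1), symmetric] Gw(4)[OF b(1), symmetric]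
        proof (rule subsetI, rule ccontr)
          fix i assume i: "i \<in> {i. (v - v') i \<noteq> 0}" "i \<notin> T \<union> ({i. w a i \<noteq> 0} \<union> {i. w b i \<noteq> 0})"
          then have "z i = y i" "w a i = 0" "w b i = 0"
            using T(3) by auto
          then show False
            using i(1) by (simp add: a(3) b(3) val_def scale_word_def)
        qed
      qed (use T supp2 a b in auto)
    next
      case 2
      then show ?thesis
        using mixed \<open>v - v' \<in> C\<close> by blast
    next
      case 3
      have "v' - v \<in> C"
        using word.subspace_neg[OF C(1) \<open>v - v' \<in> C\<close>] by simp
      then show ?thesis
        using mixed[of v' v] 3 by simp
    next
      case 4
      show ?thesis
      proof (rule short[OF \<open>v - v' \<in> C\<close> finG0])
        show "{i. (v - v') i \<noteq> 0} \<subseteq> G0"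
        proof (rule subsetI, rule ccontr)
          fix i assume "i \<in> {i. (v - v') i \<noteq> 0}" "i \<notin> G0"
          then show False
            using Y0[OF 4(1), of i] Y0[OF 4(2), of i] by simp
        qed
      qed (use cG0 d in simp)
    qed
  qed
  have "card C * card (val ` I \<union> Y) \<le> card D"
  proof (rule card_packing)
    show "finite D"
      unfolding D_def by (rule finite_parity_words) simp
    show "C \<subseteq> D"
      using C(2) by (simp add: D_def)
    show "val ` I \<union> Y \<subseteq> D"
      using valD YD by blast
  qed (use subD C(1) close in blast)+
  then show ?thesis
    by (simp add: cW D_def)
qed

lemma card_parity_words_triples:
  fixes h :: "nat \<Rightarrow> 'a::{field,finite}"
  assumes "partition_on {1..3 * L} \<G>" "card \<G> = L" "\<And>i. i \<in> {1..3 * L} \<Longrightarrow> h i \<noteq> 0"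
  shows "card (parity_words {1..3 * L} \<G> h) = CARD('a) ^ (2 * L)"
proof -
  have "card (parity_words {1..3 * L} \<G> h) * CARD('a) ^ card \<G> = CARD('a) ^ card {1..3 * L}"
    by (rule card_parity_words) (use assms in auto)
  also have "\<dots> = CARD('a) ^ (2 * L) * CARD('a) ^ card \<G>"
    by (simp add: assms(2) flip: power_add)
  finally show ?thesis
    using CARD_field_ge_2[where 'a='a] by simp
qed

section \<open>Optimal codes of locality two and distance eight\<close>

text \<open>The coordinates in \<open>S\<close> are kept as zeros instead of being deleted, so that
  all shortenings remain subspaces of the same space of words.\<close>

definition shortened :: "(nat \<Rightarrow> 'a::zero) set \<Rightarrow> nat set \<Rightarrow> (nat \<Rightarrow> 'a) set" where
  "shortened C S = {x \<in> C. \<forall>i\<in>S. x i = 0}"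

lemma subspace_shortened: "word.subspace C \<Longrightarrow> word.subspace (shortened C S)"
  by (auto simp: word.subspace_def shortened_def scale_word_def)

text \<open>Each additional zero coordinate passes to the kernel of an evaluation, which takes at
  most \<open>q\<close> values.\<close>

lemma card_shortened_Un:
  fixes C :: "(nat \<Rightarrow> 'a::{field,finite}) set"
  assumes C: "word.subspace C" "finite C" and T: "finite T"
  shows "card (shortened C S) \<le> CARD('a) ^ card T * card (shortened C (S \<union> T))"
  using T
proof (induction T rule: finite_induct)
  case (insert j T)
  let ?D = "shortened C (S \<union> T)"
  have sub: "word.subspace ?D"
    using subspace_shortened[OF C(1)] .
  have fin: "finite ?D"
    using C(2) by (simp add: shortened_def)
  have "card ?D = card {x \<in> ?D. x j = 0} * card ((\<lambda>x. x j) ` ?D)"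
    by (rule card_kernel_image[OF fin word.subspace_diff[OF sub] word.subspace_add[OF sub]]) auto
  also have "{x \<in> ?D. x j = 0} = shortened C (S \<union> insert j T)"
    by (auto simp: shortened_def)
  also have "card ((\<lambda>x. x j) ` ?D) \<le> CARD('a)"
    by (rule card_mono) auto
  finally have "card ?D \<le> card (shortened C (S \<union> insert j T)) * CARD('a)"
    by simp
  then have "CARD('a) ^ card T * card ?D \<le> CARD('a) ^ card T * (card (shortened C (S \<union> insert j T)) * CARD('a))"
    by (rule mult_left_mono) simp
  with insert.IH have "card (shortened C S) \<le> CARD('a) ^ card T * (card (shortened C (S \<union> insert j T)) * CARD('a))"
    by (rule order_trans)
  then show ?case
    using insert.hyps by (simp add: ac_simps)
qed simp

text \<open>The repaired coordinate comes for free: a word that vanishes on the repair set vanishes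
  there too.\<close>

lemma shortened_repair_set:
  assumes "repair_set n r C i R" "R \<subseteq> S"
  shows "shortened C (insert i S) = shortened C S"
proof -
  obtain \<kappa> where \<kappa>: "\<And>c. c \<in> C \<Longrightarrow> c i = (\<Sum>j\<in>R. \<kappa> j * c j)"
    using assms(1) unfolding repair_set_def by blast
  have "x i = 0" if "x \<in> C" "\<forall>j\<in>S. x j = 0" for x
    using \<kappa>[OF that(1)] that(2) assms(2) by (simp add: subset_iff)
  then show ?thesis
    by (auto simp: shortened_def)
qed

lemma finite_repair_set: "repair_set n r C i R \<Longrightarrow> finite R"
  unfolding repair_set_def using finite_subset[of R "{1..n} - {i}"] by simp

text \<open>Absorbing a repair group into \<open>S\<close> costs at most \<open>card (R - S)\<close>
  dimensions but enlarges \<open>S\<close> by one coordinate more. This surplus of one per group is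
  the source of the Singleton-type bound for locally repairable codes.\<close>

lemma card_shortened_repair:
  fixes C :: "(nat \<Rightarrow> 'a::{field,finite}) set"
  assumes C: "word.subspace C" "finite C" and R: "repair_set n r C i R" and "i \<notin> S" "finite S"
    and e: "CARD('a) ^ e \<le> card (shortened C S)"
  shows "CARD('a) ^ (e - card (R - S)) \<le> card (shortened C (S \<union> insert i R))"
    and "card (S \<union> insert i R) = card S + card (R - S) + 1"
proof -
  have finR: "finite R"
    using finite_repair_set[OF R] .
  have "i \<notin> R"
    using R by (auto simp: repair_set_def)
  have insert_eq: "S \<union> insert i R = insert i (S \<union> (R - S))"
    by auto
  then have sh: "shortened C (S \<union> insert i R) = shortened C (S \<union> (R - S))"
    using shortened_repair_set[OF R, of "S \<union> (R - S)"] by auto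
  let ?q = "CARD('a)"
  let ?t = "card (R - S)"
  have le: "?q ^ e \<le> ?q ^ ?t * card (shortened C (S \<union> insert i R))"
    using e card_shortened_Un[OF C, of "R - S" S] finR sh by simp
  show "?q ^ (e - ?t) \<le> card (shortened C (S \<union> insert i R))"
  proof (cases "?t \<le> e")
    case True
    then have "?q ^ ?t * ?q ^ (e - ?t) \<le> ?q ^ ?t * card (shortened C (S \<union> insert i R))"
      using le by (simp flip: power_add)
    then show ?thesis
      using CARD_field_ge_2[where 'a='a] by simp
  next
    case False
    \<comment> \<open>Here the exponent \<open>e - card (R - S)\<close> is truncated to 0, so only
      nonemptiness has to be shown.\<close>
    have "0 \<in> shortened C (S \<union> insert i R)"
      using word.subspace_0[OF C(1)] by (simp add: shortened_def)
    moreover have "finite (shortened C (S \<union> insert i R))"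
      using C(2) by (simp add: shortened_def)
    ultimately have "card (shortened C (S \<union> insert i R)) > 0"
      by (auto simp: card_gt_0_iff)
    then show ?thesis
      using False by simp
  qed
  show "card (S \<union> insert i R) = card S + ?t + 1"
    unfolding insert_eq using \<open>i \<notin> S\<close> \<open>i \<notin> R\<close> \<open>finite S\<close> finR card_Un_disjoint[of S "R - S"] by simp
qed

text \<open>The hypothetical competitor, about whose repair groups neither disjointness nor exact
  size is known. The number 8 is the extremal value \<open>n - k - \<lceil>k / 2\<rceil> + 2\<close>
  for \<open>n = 3 * L\<close> and \<open>k = 2 * L - 4\<close>.\<close>

locale optimal_lrc =
  fixes C :: "(nat \<Rightarrow> 'a::{field,finite}) set" and L :: nat
  assumes C_words: "C \<subseteq> words (3 * L)" and subspace_C: "word.subspace C"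
    and card_C: "card C = CARD('a) ^ (2 * L - 4)"
    and weight_C: "\<And>x. x \<in> C \<Longrightarrow> x \<noteq> 0 \<Longrightarrow> 8 \<le> weight (3 * L) x"
    and repairable: "\<And>i. i \<in> {1..3 * L} \<Longrightarrow> \<exists>R. repair_set (3 * L) 2 C i R"
    and L_ge_3: "3 \<le> L"
begin

lemma finite_C: "finite C"
  using finite_subset[OF C_words finite_words] .

text \<open>Singleton bound for distance 8, with \<open>e\<close> a lower bound for the dimension of
  the shortened code; \<open>1 \<le> e\<close> makes that code nonzero.\<close>

lemma shortened_bound:
  assumes S: "S \<subseteq> {1..3 * L}" and e: "CARD('a) ^ e \<le> card (shortened C S)" and "1 \<le> e"
  shows "card S + 8 \<le> 3 * L" "e + card S + 7 \<le> 3 * L"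
proof -
  have q: "2 \<le> CARD('a)"
    by (rule CARD_field_ge_2)
  have "CARD('a) ^ 1 \<le> CARD('a) ^ e"
    using \<open>1 \<le> e\<close> by (rule power_increasing) simp
  then have "card (shortened C S) \<noteq> 1"
    using e q unfolding power_one_right by linarith
  then have ne: "shortened C S \<noteq> {0}"
    by force
  have *: "card S + 8 \<le> 3 * L \<and> card (shortened C S) \<le> CARD('a) ^ (3 * L - card S - (8 - 1))"
  proof (rule card_shortened_le)
    show "shortened C S \<subseteq> words (3 * L)"
      using C_words by (auto simp: shortened_def)
    show "8 \<le> weight (3 * L) x" if "x \<in> shortened C S" "x \<noteq> 0" for x
      using weight_C that by (simp add: shortened_def)
    show "x i = 0" if "x \<in> shortened C S" "i \<in> S" for x i
      using that by (simp add: shortened_def)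
  qed (use S ne subspace_shortened[OF subspace_C] in simp_all)
  then show "card S + 8 \<le> 3 * L"
    by simp
  have "CARD('a) ^ e \<le> CARD('a) ^ (3 * L - card S - 7)"
    using * e by simp
  then have "e \<le> 3 * L - card S - 7"
    by (rule power_le_imp_le_exp[rotated]) (use q in simp)
  then show "e + card S + 7 \<le> 3 * L"
    using conjunct1[OF *] by linarith
qed

text \<open>
  A union \<open>S\<close> of \<open>m\<close> repair groups satisfies \<open>e + card S \<ge> 2 * L - 4 + m\<close> for the dimension \<open>e\<close> of
  the code shortened at \<open>S\<close>. If its rank is less than \<open>2 * m\<close>, then adding further groups until
  \<open>m = L - 2\<close> leaves \<open>e \<ge> 1\<close>, which violates the Singleton bound for the shortened code.
\<close>

lemma no_rank_deficient_union:
  assumes "m \<le> L - 2" "S \<subseteq> {1..3 * L}" "CARD('a) ^ e \<le> card (shortened C S)"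
    "2 * L - 4 + m \<le> e + card S" "2 * L - 3 \<le> e + 2 * m"
  shows False
  using assms
proof (induction "L - 2 - m" arbitrary: m S e)
  case 0
  \<comment> \<open>Now \<open>m = L - 2\<close>, so the rank condition leaves a dimension, and the
    size condition reads \<open>e + card S \<ge> 3 * L - 6\<close>, one more than the Singleton
    bound permits.\<close>
  then have "1 \<le> e"
    using L_ge_3 by linarith
  then show ?case
    using shortened_bound(2)[OF 0(3,4)] 0 L_ge_3 by linarith
next
  case (Suc l)
  \<comment> \<open>From \<open>m \<le> L - 3\<close>. Thus the next group, which costs at most two
    dimensions, causes no truncation in \<open>e - card (R - S)\<close>.\<close>
  then have "3 \<le> e"
    by linarith
  have finS: "finite S"
    using Suc.prems(2) finite_subset by blast
  have "card S + 8 \<le> 3 * L"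
    by (rule shortened_bound(1)[OF Suc.prems(2,3)]) (use \<open>3 \<le> e\<close> in simp)
  then have "\<not> {1..3 * L} \<subseteq> S"
    using card_mono[OF finS, of "{1..3 * L}"] by auto
  then obtain i where i: "i \<in> {1..3 * L}" "i \<notin> S"
    by blast
  then obtain R where R: "repair_set (3 * L) 2 C i R"
    using repairable by blast
  then have cR: "card (R - S) \<le> 2"
    using card_mono[OF finite_repair_set[OF R], of "R - S"] by (auto simp: repair_set_def)
  note new = card_shortened_repair[OF subspace_C finite_C R i(2) finS Suc.prems(3)]
  show ?case
  proof (rule Suc.hyps(1))
    show "l = L - 2 - Suc m"
      using Suc.hyps(2) by simp
    show "Suc m \<le> L - 2"
      using Suc.hyps(2) by simp
    show "S \<union> insert i R \<subseteq> {1..3 * L}"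
      using Suc.prems(2) i R by (auto simp: repair_set_def)
    show "CARD('a) ^ (e - card (R - S)) \<le> card (shortened C (S \<union> insert i R))"
      by (rule new(1))
    show "2 * L - 4 + Suc m \<le> (e - card (R - S)) + card (S \<union> insert i R)"
      using new(2) cR \<open>3 \<le> e\<close> Suc.prems(4) by linarith
    show "2 * L - 3 \<le> (e - card (R - S)) + 2 * Suc m"
    proof (rule order_trans[OF Suc.prems(5)])
      show "e + 2 * m \<le> (e - card (R - S)) + 2 * Suc m"
        using cR by simp
    qed
  qed
qed

lemma shortened_empty: "CARD('a) ^ (2 * L - 4) \<le> card (shortened C {})"
  by (simp add: shortened_def card_C)

text \<open>A repair set with at most one element would be a union of \<open>m = 1\<close> groups of
  rank below 2.\<close>

lemma repair_set_card:
  assumes "i \<in> {1..3 * L}" "repair_set (3 * L) 2 C i R"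
  shows "card (insert i R) = 3"
proof (rule ccontr)
  assume "card (insert i R) \<noteq> 3"
  moreover have "i \<notin> R" "finite R" "card R \<le> 2"
    using assms finite_repair_set[OF assms(2)] by (auto simp: repair_set_def)
  ultimately have "card R \<le> 1"
    by simp
  note new = card_shortened_repair[OF subspace_C finite_C assms(2) _ _ shortened_empty]
  have cR: "card ({} \<union> insert i R) = card R + 1"
    using new(2) by simp
  show False
  proof (rule no_rank_deficient_union[of 1 "{} \<union> insert i R" "2 * L - 4 - card R"])
    show "CARD('a) ^ (2 * L - 4 - card R) \<le> card (shortened C ({} \<union> insert i R))"
      using new(1) by simp
    show "{} \<union> insert i R \<subseteq> {1..3 * L}"
      using assms by (auto simp: repair_set_def)
  qed (use \<open>card R \<le> 1\<close> cR L_ge_3 in linarith)+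
qed

text \<open>If the second group met the first, the two together would have rank at most 3, less than
  \<open>2 * m\<close> for \<open>m = 2\<close>. The bound \<open>4 \<le> L\<close> ensures that
  \<open>m = 2\<close> is at most \<open>L - 2\<close>.\<close>

lemma repair_sets_disjoint:
  assumes "4 \<le> L" and i: "i \<in> {1..3 * L}" "repair_set (3 * L) 2 C i R"
    and j: "j \<in> {1..3 * L}" "repair_set (3 * L) 2 C j R'" "j \<notin> insert i R"
  shows "insert i R \<inter> insert j R' = {}"
proof (rule ccontr)
  assume "insert i R \<inter> insert j R' \<noteq> {}"
  moreover have "j \<notin> R'" "i \<notin> R" "finite R" "finite R'"
    using i j finite_repair_set[OF i(2)] finite_repair_set[OF j(2)] by (auto simp: repair_set_def)
  ultimately have "R' - insert i R \<subset> R'"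
    using j(3) by blast
  then have "card (R' - insert i R) < card R'"
    using \<open>finite R'\<close> by (rule psubset_card_mono[rotated])
  moreover have "card R' = 2" "card R = 2"
    using repair_set_card[OF i] repair_set_card[OF j(1,2)] \<open>j \<notin> R'\<close> \<open>i \<notin> R\<close> \<open>finite R\<close> \<open>finite R'\<close>
    by simp_all
  ultimately have small: "card (R' - insert i R) \<le> 1"
    by linarith
  have "CARD('a) ^ (2 * L - 4 - 2) \<le> card (shortened C (insert i R))"
    using card_shortened_repair(1)[OF subspace_C finite_C i(2) _ _ shortened_empty] \<open>card R = 2\<close> by simp
  note new = card_shortened_repair[OF subspace_C finite_C j(2,3) _ this]
  show False
  proof (rule no_rank_deficient_union)
    show "2 \<le> L - 2"
      using \<open>4 \<le> L\<close> by simp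
    show "CARD('a) ^ (2 * L - 4 - 2 - card (R' - insert i R)) \<le> card (shortened C (insert i R \<union> insert j R'))"
      using new(1) \<open>finite R\<close> by simp
    have "card (insert i R \<union> insert j R') = 3 + card (R' - insert i R) + 1"
      using new(2) repair_set_card[OF i] \<open>finite R\<close> by simp
    then show "2 * L - 4 + 2 \<le> 2 * L - 4 - 2 - card (R' - insert i R) + card (insert i R \<union> insert j R')"
      using small \<open>4 \<le> L\<close> by linarith
    show "insert i R \<union> insert j R' \<subseteq> {1..3 * L}"
      using i j by (auto simp: repair_set_def)
    show "2 * L - 3 \<le> 2 * L - 4 - 2 - card (R' - insert i R) + 2 * 2"
      using small \<open>4 \<le> L\<close> by linarith
  qed
qed

text \<open>Greedy choice: fewer than \<open>L\<close> triples leave some coordinate uncovered, and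
  any repair group of an uncovered coordinate avoids all groups chosen so far.\<close>

lemma disjoint_groups_exist:
  assumes "4 \<le> L" "m \<le> L"
  shows "\<exists>\<G>. finite \<G> \<and> card \<G> = m \<and> disjoint \<G> \<and>
    (\<forall>G\<in>\<G>. \<exists>i\<in>{1..3 * L}. \<exists>R. repair_set (3 * L) 2 C i R \<and> G = insert i R)"
  using assms(2)
proof (induction m)
  case 0
  then show ?case
    by (intro exI[of _ "{}"]) simp
next
  case (Suc m)
  obtain \<G> where \<G>: "finite \<G>" "card \<G> = m" "disjoint \<G>"
    "\<forall>G\<in>\<G>. \<exists>i\<in>{1..3 * L}. \<exists>R. repair_set (3 * L) 2 C i R \<and> G = insert i R"
    using Suc.IH[OF Suc_leD[OF Suc.prems]] by blast
  note groups = bspec[OF \<G>(4)]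
  have card3: "card G = 3" if "G \<in> \<G>" for G
    using groups[OF that] repair_set_card by blast
  have "card (\<Union>\<G>) \<le> (\<Sum>G\<in>\<G>. card G)"
    by (rule card_Union_le_sum_card)
  also have "\<dots> = 3 * m"
    using card3 \<G>(2) by simp
  finally have "card (\<Union>\<G>) < card {1..3 * L}"
    using Suc.prems by simp
  moreover have "finite G" if "G \<in> \<G>" for G
    using card3[OF that] card.infinite by fastforce
  then have "finite (\<Union>\<G>)"
    using \<G>(1) by blast
  ultimately have "\<not> {1..3 * L} \<subseteq> \<Union>\<G>"
    using card_mono[of "\<Union>\<G>" "{1..3 * L}"] by linarith
  then obtain j where j: "j \<in> {1..3 * L}" "j \<notin> \<Union>\<G>"
    by blast
  obtain R where R: "repair_set (3 * L) 2 C j R"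
    using repairable[OF j(1)] by blast
  have disj: "G \<inter> insert j R = {}" if "G \<in> \<G>" for G
    using groups[OF that] repair_sets_disjoint[OF assms(1) _ _ j(1) R] j(2) that by blast
  have "insert j R \<notin> \<G>"
    using j(2) by blast
  show ?case
  proof (intro exI[of _ "insert (insert j R) \<G>"] conjI)
    show "disjoint (insert (insert j R) \<G>)"
      using \<G>(3) disj by (auto simp: disjoint_def)
    show "\<forall>G\<in>insert (insert j R) \<G>. \<exists>i\<in>{1..3 * L}. \<exists>R. repair_set (3 * L) 2 C i R \<and> G = insert i R"
      using groups j(1) R by blast
  qed (use \<G>(1,2) \<open>insert j R \<notin> \<G>\<close> in simp_all)
qed

text \<open>\<open>L\<close> disjoint triples exhaust the \<open>3 * L\<close> coordinates. Each
  repair equation, moved to one side with coefficient -1 at the repaired coordinate, is a check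
  without zero coefficients, and by disjointness these coefficients glue to a single
  \<open>h\<close>.\<close>

lemma exists_parity_form:
  assumes "4 \<le> L"
  shows "\<exists>\<G> h. partition_on {1..3 * L} \<G> \<and> card \<G> = L \<and> (\<forall>G\<in>\<G>. card G = 3) \<and>
    (\<forall>i\<in>{1..3 * L}. h i \<noteq> 0) \<and> C \<subseteq> parity_words {1..3 * L} \<G> h"
proof -
  obtain \<G> where \<G>: "finite \<G>" "card \<G> = L" "disjoint \<G>"
    "\<And>G. G \<in> \<G> \<Longrightarrow> \<exists>i\<in>{1..3 * L}. \<exists>R. repair_set (3 * L) 2 C i R \<and> G = insert i R"
    using disjoint_groups_exist[OF assms order_refl] by metis
  have card3: "card G = 3" if "G \<in> \<G>" for G
    using \<G>(4)[OF that] repair_set_card by blast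
  have finG: "finite G" if "G \<in> \<G>" for G
    using card3[OF that] card.infinite by fastforce
  have sub: "G \<subseteq> {1..3 * L}" if "G \<in> \<G>" for G
    using \<G>(4)[OF that] unfolding repair_set_def by blast
  have "card (\<Union>\<G>) = (\<Sum>G\<in>\<G>. card G)"
    using \<G>(3) finG by (intro card_Union_disjoint) auto
  also have "\<dots> = 3 * L"
    using card3 \<G>(2) by simp
  finally have "\<Union>\<G> = {1..3 * L}"
    using sub by (intro card_subset_eq) auto
  moreover have "{} \<notin> \<G>"
    using card3 by fastforce
  ultimately have part: "partition_on {1..3 * L} \<G>"
    using \<G>(3) by (simp add: partition_on_def)
  have "\<exists>g. (\<forall>j\<in>G. g j \<noteq> 0) \<and> (\<forall>c\<in>C. (\<Sum>j\<in>G. g j * c j) = 0)" if "G \<in> \<G>" for G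
  proof -
    obtain i R where i: "repair_set (3 * L) 2 C i R" "G = insert i R"
      using \<G>(4)[OF \<open>G \<in> \<G>\<close>] by blast
    then obtain \<kappa> where \<kappa>: "\<forall>j\<in>R. \<kappa> j \<noteq> 0" "\<forall>c\<in>C. c i = (\<Sum>j\<in>R. \<kappa> j * c j)"
      unfolding repair_set_def by blast
    have iR: "i \<notin> R" "finite R"
      using i(1) finite_repair_set[OF i(1)] by (auto simp: repair_set_def)
    define g where "g = (\<lambda>j. if j = i then - 1 else \<kappa> j)"
    have "(\<Sum>j\<in>R. g j * c j) = (\<Sum>j\<in>R. \<kappa> j * c j)" for c
      using iR(1) by (intro sum.cong) (auto simp: g_def)
    then have "(\<Sum>j\<in>G. g j * c j) = 0" if "c \<in> C" for c
      using \<kappa>(2) that iR i(2) by (simp add: g_def)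
    moreover have "\<forall>j\<in>G. g j \<noteq> 0"
      using \<kappa>(1) i(2) by (auto simp: g_def)
    ultimately show ?thesis
      by blast
  qed
  then obtain g where g: "\<And>G j. G \<in> \<G> \<Longrightarrow> j \<in> G \<Longrightarrow> g G j \<noteq> 0"
    "\<And>G c. G \<in> \<G> \<Longrightarrow> c \<in> C \<Longrightarrow> (\<Sum>j\<in>G. g G j * c j) = 0"
    by metis
  have "\<forall>j\<in>{1..3 * L}. \<exists>G\<in>\<G>. j \<in> G"
    unfolding partition_onD1[OF part] by blast
  then obtain b where b: "\<And>j. j \<in> {1..3 * L} \<Longrightarrow> b j \<in> \<G>" "\<And>j. j \<in> {1..3 * L} \<Longrightarrow> j \<in> b j"
    by metis
  have bG: "b j = G" if "G \<in> \<G>" "j \<in> G" for j G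
  proof -
    have "j \<in> {1..3 * L}"
      using sub that by blast
    then show ?thesis
      using partition_on_unique[OF part b(1) that(1) b(2) that(2)] by blast
  qed
  define h where "h = (\<lambda>j. g (b j) j)"
  have h0: "\<forall>i\<in>{1..3 * L}. h i \<noteq> 0"
    using g(1) b by (simp add: h_def)
  have "c \<in> parity_words {1..3 * L} \<G> h" if "c \<in> C" for c
  proof -
    have "(\<Sum>j\<in>G. h j * c j) = 0" if "G \<in> \<G>" for G
    proof -
      have "(\<Sum>j\<in>G. h j * c j) = (\<Sum>j\<in>G. g G j * c j)"
        by (rule sum.cong) (simp_all add: h_def bG[OF that])
      then show ?thesis
        using g(2)[OF that \<open>c \<in> C\<close>] by simp
    qed
    moreover have "c i = 0" if "i \<notin> {1..3 * L}" for i
      using C_words \<open>c \<in> C\<close> that unfolding words_def by blast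
    ultimately show ?thesis
      unfolding parity_words_def by blast
  qed
  then show ?thesis
    using part \<G>(2) card3 h0 by blast
qed

section \<open>Length bounds for distance eight\<close>

text \<open>Since \<open>3 + 4 < 8\<close>, all \<open>q ^ 2\<close> words on the distinguished
  triple may be taken as \<open>Z\<close>; the packing inequality then reduces to
  \<open>(3 * L - 3) * (q - 1) + 1 \<le> q ^ 2\<close>.\<close>

lemma length_bound_of_ge_4:
  assumes "4 \<le> L"
  shows "3 * L \<le> CARD('a) + 4"
proof -
  let ?q = "CARD('a)"
  have q: "2 \<le> ?q"
    by (rule CARD_field_ge_2)
  obtain \<G> h where part: "partition_on {1..3 * L} \<G>" and c\<G>: "card \<G> = L"
    and card3: "\<And>G. G \<in> \<G> \<Longrightarrow> card G = 3"
    and h: "\<And>i. i \<in> {1..3 * L} \<Longrightarrow> h i \<noteq> 0" and CD: "C \<subseteq> parity_words {1..3 * L} \<G> h"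
    using exists_parity_form[OF assms] by metis
  have "\<G> \<noteq> {}"
    using c\<G> assms by auto
  then obtain G0 where G0: "G0 \<in> \<G>"
    by blast
  have finG0: "finite G0"
    using card3[OF G0] card.infinite by fastforce
  have G0_sub: "G0 \<subseteq> {1..3 * L}"
    unfolding partition_onD1[OF part] using G0 by blast
  define Z where "Z = parity_words G0 {G0} h"
  have cZ: "card Z = ?q\<^sup>2"
    unfolding Z_def by (rule card_parity_words_one) (use card3[OF G0] h G0_sub in auto)
  have "card C * ((3 * L - 3) * (?q - 1) * card Z + ?q\<^sup>2) \<le> card (parity_words {1..3 * L} \<G> h)"
  proof (rule packing_bound[OF part card3 h subspace_C CD weight_C _ G0])
    show "\<exists>T. card T + 4 < 8 \<and> finite T \<and> {i. (y - z) i \<noteq> 0} \<subseteq> T" if "y \<in> Z" "z \<in> Z" for y z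
    proof (intro exI[of _ G0] conjI)
      show "{i. (y - z) i \<noteq> 0} \<subseteq> G0"
      proof (rule subsetI, rule ccontr)
        fix i assume "i \<in> {i. (y - z) i \<noteq> 0}" "i \<notin> G0"
        then show False
          using that by (simp add: Z_def parity_words_def)
      qed
    qed (use card3[OF G0] finG0 in auto)
  qed (simp_all add: Z_def)
  then have "?q ^ (2 * L - 4) * ((3 * L - 3) * (?q - 1) * ?q\<^sup>2 + ?q\<^sup>2) \<le> ?q ^ (2 * L)"
    by (simp only: card_C cZ card_parity_words_triples[OF part c\<G> h])
  also have "\<dots> = ?q ^ (2 * L - 4) * (?q\<^sup>2 * ?q\<^sup>2)"
    using assms by (simp flip: power_add)
  finally have "(3 * L - 3) * (?q - 1) * ?q\<^sup>2 + ?q\<^sup>2 \<le> ?q\<^sup>2 * ?q\<^sup>2"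
    using q by simp
  then have "((3 * L - 3) * (?q - 1) + 1) * ?q\<^sup>2 \<le> ?q\<^sup>2 * ?q\<^sup>2"
    by (simp only: add_mult_distrib mult_1)
  then have le: "(3 * L - 3) * (?q - 1) + 1 \<le> ?q\<^sup>2"
    using q unfolding mult_le_cancel2 by simp
  \<comment> \<open>With \<open>q = p + 1\<close> the difference \<open>q ^ 2 - 1\<close> factors as
    \<open>p * (p + 2)\<close>, and \<open>p\<close> cancels.\<close>
  obtain p where p: "?q = p + 1" "1 \<le> p"
    using q by (metis add.commute le_Suc_ex numeral_2_eq_2 plus_1_eq_Suc Suc_le_D Suc_le_mono One_nat_def)
  have "(3 * L - 3) * p \<le> (p + 2) * p"
    using le unfolding p(1) by (simp add: power2_eq_square algebra_simps)
  then have "3 * L - 3 \<le> p + 2"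
    using p(2) unfolding mult_le_cancel2 by simp
  then show ?thesis
    using p by simp
qed

lemma length_bound_of_eq_3:
  assumes "L = 3"
  shows "8 \<le> CARD('a)"
proof -
  have q: "2 \<le> CARD('a)"
    by (rule CARD_field_ge_2)
  \<comment> \<open>If coordinate 1 were zero throughout, shortening there would cost no dimension,
    and \<open>2 + 1 + 7 \<le> 9\<close> would follow.\<close>
  have "\<exists>c'\<in>C. c' 1 \<noteq> 0"
  proof (rule ccontr)
    assume "\<not> (\<exists>c'\<in>C. c' 1 \<noteq> 0)"
    then have "shortened C {1} = C"
      by (auto simp: shortened_def)
    then have "CARD('a) ^ 2 \<le> card (shortened C {1})"
      using card_C assms by simp
    from shortened_bound(2)[OF _ this] show False
      using assms by simp
  qed
  then obtain c' where c': "c' \<in> C" "c' 1 \<noteq> 0"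
    by blast
  have "card (shortened C {}) \<le> CARD('a) ^ card {1 :: nat} * card (shortened C ({} \<union> {1}))"
    by (rule card_shortened_Un[OF subspace_C finite_C]) simp
  then have "CARD('a) * CARD('a) \<le> CARD('a) * card (shortened C {1})"
    using card_C assms by (simp add: shortened_def power2_eq_square)
  then have "CARD('a) \<le> card (shortened C {1})"
    using q unfolding mult_le_cancel1 by linarith
  then have "card (shortened C {1}) \<noteq> 1"
    using q by linarith
  then have "shortened C {1} \<noteq> {0}"
    by force
  moreover have "0 \<in> shortened C {1}"
    using word.subspace_0[OF subspace_C] by (simp add: shortened_def)
  ultimately obtain c where "c \<in> shortened C {1}" "c \<noteq> 0"
    by blast
  then have c: "c \<in> C" "c 1 = 0" "c \<noteq> 0"
    by (simp_all add: shortened_def)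
  have full: "card ({1..9} - {i \<in> {1..9}. x i \<noteq> 0}) \<le> 1" if "x \<in> C" "x \<noteq> 0" for x
    using weight_C[OF that] assms by (subst card_Diff_subset) (auto simp: weight_def)
  have two_zeros: "x = 0" if "x \<in> C" "x i = 0" "x j = 0" "i \<in> {1..9}" "j \<in> {1..9}" "i \<noteq> j" for x i j
  proof (rule ccontr)
    assume "x \<noteq> 0"
    have "card {i, j} \<le> card ({1..9} - {i \<in> {1..9}. x i \<noteq> 0})"
      by (rule card_mono) (use that in auto)
    with full[OF that(1) \<open>x \<noteq> 0\<close>] show False
      using \<open>i \<noteq> j\<close> by simp
  qed
  have cj: "c j \<noteq> 0" if "j \<in> {2..9}" for j
    using two_zeros[OF c(1,2), of j] c(3) that by auto
  have "inj_on (\<lambda>j. - c' j / c j) {2..9}"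
  proof (rule inj_onI, rule ccontr)
    fix i j assume ij: "i \<in> {2..9}" "j \<in> {2..9}" "- c' i / c i = - c' j / c j" "i \<noteq> j"
    \<comment> \<open>Equal slopes make this combination vanish at both \<open>i\<close> and
      \<open>j\<close>, although its value at 1 is \<open>c' 1\<close>.\<close>
    let ?x = "c' + scale_word (- c' i / c i) c"
    have "?x \<in> C"
      by (rule word.subspace_add[OF subspace_C c'(1) word.subspace_scale[OF subspace_C c(1)]])
    moreover have "?x i = 0"
      using cj[OF ij(1)] by (simp add: scale_word_def)
    moreover have "?x j = 0"
      using cj[OF ij(2)] unfolding ij(3) by (simp add: scale_word_def)
    moreover have "i \<in> {1..9}" "j \<in> {1..9}"
      using ij(1,2) by auto
    ultimately have "?x = 0"
      using two_zeros[of ?x i j] ij(4) by blast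
    from fun_cong[OF this, of 1] show False
      using c(2) c'(2) by (simp add: scale_word_def)
  qed
  then have "card {2..9 :: nat} \<le> CARD('a)"
    by (rule card_inj_on_le) auto
  then show ?thesis
    by simp
qed

lemma length_bound: "3 * L \<le> CARD('a) + 4"
  using length_bound_of_ge_4 length_bound_of_eq_3 L_ge_3 by (cases "L = 3") auto

end

lemma lrc_distance_le_7:
  fixes C :: "(nat \<Rightarrow> 'a::{field,finite}) set"
  assumes C: "lrc (3 * L) (2 * L - 4) d 2 C" and L: "3 \<le> L" "CARD('a) + 4 < 3 * L"
  shows "d \<le> 7"
proof (rule ccontr)
  assume "\<not> d \<le> 7"
  have lin: "C \<subseteq> words (3 * L)" "word.subspace C" "word.dim C = 2 * L - 4" "min_dist (3 * L) C = d"
    using C by (auto simp: lrc_def linear_code_def)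
  have "optimal_lrc C L"
  proof
    show "8 \<le> weight (3 * L) x" if "x \<in> C" "x \<noteq> 0" for x
      using min_dist_le_weight[OF lin(1,2) that] lin(4) \<open>\<not> d \<le> 7\<close> by simp
    show "\<exists>R. repair_set (3 * L) 2 C i R" if "i \<in> {1..3 * L}" for i
      using C that unfolding lrc_def by blast
    show "card C = CARD('a) ^ (2 * L - 4)"
      using card_linear_code[OF lin(1,2)] lin(3) by simp
  qed (use lin L in auto)
  then show False
    using optimal_lrc.length_bound L(2) by fastforce
qed

section \<open>Lines and spreads\<close>

lemma span_single_eq:
  fixes v w :: "'a::field ^ 'n"
  assumes "v \<in> vec.span {w}" "v \<noteq> 0"
  shows "vec.span {v} = vec.span {w}"
proof -
  obtain c where c: "v = c *s w"
    using assms(1) unfolding vec.span_singleton by blast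
  then have "c \<noteq> 0"
    using assms(2) by auto
  then have "w = inverse c *s v"
    using c by (simp add: vector_smult_assoc)
  then have "w \<in> vec.span {v}"
    unfolding vec.span_singleton by blast
  then show ?thesis
    using assms(1) by (simp add: vec.span_minimal subset_antisym)
qed

lemma span_single_in_one_dim_subspaces:
  fixes v :: "'a::field ^ 'n"
  assumes "vec.subspace V" "v \<in> V" "v \<noteq> 0"
  shows "vec.span {v} \<in> one_dim_subspaces V"
  using assms by (simp add: one_dim_subspaces_def vec.span_minimal)

lemma one_dim_subspaceE:
  fixes l :: "('a::{field,finite} ^ 'n::finite) set"
  assumes "l \<in> one_dim_subspaces V"
  obtains v where "v \<in> V" "v \<noteq> 0" "l = vec.span {v}"
proof -
  have l: "l \<subseteq> V" "vec.subspace l" "vec.dim l = 1"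
    using assms by (auto simp: one_dim_subspaces_def)
  then obtain v where v: "v \<in> l" "v \<noteq> 0"
    using vec.dim_eq_0[of l] by force
  have "card (vec.span {v}) = card l"
    using card_subspace_vec[OF l(2)] card_subspace_vec[OF vec.subspace_span[of "{v}"]] l(3) v(2) by simp
  moreover have "vec.span {v} \<subseteq> l"
    using v(1) l(2) by (simp add: vec.span_minimal)
  ultimately have "vec.span {v} = l"
    by (intro card_subset_eq) auto
  then show ?thesis
    using that v l(1) by blast
qed

lemma one_dim_subspace_unique:
  fixes l :: "('a::{field,finite} ^ 'n::finite) set"
  assumes "l \<in> one_dim_subspaces V" "v \<in> l" "v \<noteq> 0"
  shows "l = vec.span {v}"
proof -
  obtain w where "l = vec.span {w}"
    using one_dim_subspaceE[OF assms(1)] by metis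
  then show ?thesis
    using span_single_eq[of v w] assms by simp
qed

lemma card_one_dim_subspaces:
  fixes V :: "('a::{field,finite} ^ 'n::finite) set"
  assumes V: "vec.subspace V"
  shows "card (one_dim_subspaces V) * (CARD('a) - 1) = card V - 1"
proof -
  have nonzero: "card (l - {0}) = CARD('a) - 1" if "l \<in> one_dim_subspaces V" for l
  proof -
    have l: "vec.subspace l" "vec.dim l = 1"
      using that by (auto simp: one_dim_subspaces_def)
    then show ?thesis
      using card_subspace_vec[OF l(1)] vec.subspace_0[OF l(1)] by (simp add: card_Diff_singleton)
  qed
  have "V - {0} = (\<Union>l\<in>one_dim_subspaces V. l - {0})"
  proof (intro subset_antisym subsetI)
    fix v assume "v \<in> V - {0}"
    then have "vec.span {v} \<in> one_dim_subspaces V"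
      using span_single_in_one_dim_subspaces[OF V] by blast
    moreover have "v \<in> vec.span {v}"
      by (simp add: vec.span_base)
    ultimately show "v \<in> (\<Union>l\<in>one_dim_subspaces V. l - {0})"
      using \<open>v \<in> V - {0}\<close> by blast
  qed (auto simp: one_dim_subspaces_def)
  then have "card (V - {0}) = card (\<Union>l\<in>one_dim_subspaces V. l - {0})"
    by simp
  also have "\<dots> = (\<Sum>l\<in>one_dim_subspaces V. card (l - {0}))"
  proof (rule card_UN_disjoint)
    show "\<forall>l\<in>one_dim_subspaces V. \<forall>l'\<in>one_dim_subspaces V. l \<noteq> l' \<longrightarrow> (l - {0}) \<inter> (l' - {0}) = {}"
      using one_dim_subspace_unique by blast
  qed auto
  also have "\<dots> = card (one_dim_subspaces V) * (CARD('a) - 1)"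
    by (simp add: nonzero)
  finally show ?thesis
    using vec.subspace_0[OF V] by (simp add: card_Diff_singleton)
qed

lemma card_one_dim_subspaces_plane:
  fixes V :: "('a::{field,finite} ^ 'n::finite) set"
  assumes V: "vec.subspace V"
  shows "vec.dim V = 2 \<Longrightarrow> card (one_dim_subspaces V) = CARD('a) + 1"
    and "vec.dim V \<le> 2 \<Longrightarrow> card (one_dim_subspaces V) \<le> CARD('a) + 1"
proof -
  \<comment> \<open>Writing \<open>q = p + 2\<close> turns \<open>q - 1\<close> and
    \<open>q + 1\<close> into \<open>p + 1\<close> and \<open>p + 3\<close>, which suits arithmetic
    in the natural numbers.\<close>
  obtain p where p: "CARD('a) = p + 2"
    using CARD_field_ge_2[where 'a='a] by (metis le_add_diff_inverse2)
  have *: "(p + 2)\<^sup>2 - 1 = (p + 3) * (p + 1)"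
    by (simp add: power2_eq_square algebra_simps)
  have card: "card (one_dim_subspaces V) * (p + 1) = (p + 2) ^ vec.dim V - 1"
    using card_one_dim_subspaces[OF V] card_subspace_vec[OF V] p by simp
  show "card (one_dim_subspaces V) = CARD('a) + 1" if "vec.dim V = 2"
  proof -
    have "card (one_dim_subspaces V) * (p + 1) = (p + 3) * (p + 1)"
      using card * that by simp
    then show ?thesis
      using p by (simp only: mult_cancel2) simp
  qed
  show "card (one_dim_subspaces V) \<le> CARD('a) + 1" if "vec.dim V \<le> 2"
  proof -
    have "(p + 2) ^ vec.dim V \<le> (p + 2)\<^sup>2"
      using that by (intro power_increasing) auto
    then have "card (one_dim_subspaces V) * (p + 1) \<le> (p + 3) * (p + 1)"
      unfolding card *[symmetric] by (rule diff_le_mono)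
    then show ?thesis
      using p by (simp only: mult_le_cancel2) simp
  qed
qed

locale spread =
  fixes S :: "('a::{field,finite} ^ 4) set set"
  assumes two_spread: "two_spread S"
begin

lemma subspace_member: "P \<in> S \<Longrightarrow> vec.subspace P"
  and dim_member: "P \<in> S \<Longrightarrow> vec.dim P = 2"
  and inter_member: "P \<in> S \<Longrightarrow> Q \<in> S \<Longrightarrow> P \<noteq> Q \<Longrightarrow> P \<inter> Q = {0}"
  and Union_members: "\<Union>S = UNIV"
  using two_spread by (auto simp: two_spread_def)

lemma card_lines: "P \<in> S \<Longrightarrow> card (one_dim_subspaces P) = CARD('a) + 1"
  using card_one_dim_subspaces_plane(1) subspace_member dim_member by blast

lemma lines_disjoint:
  assumes "P \<in> S" "Q \<in> S" "P \<noteq> Q"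
  shows "one_dim_subspaces P \<inter> one_dim_subspaces Q = {}"
proof (rule ccontr)
  assume "one_dim_subspaces P \<inter> one_dim_subspaces Q \<noteq> {}"
  then obtain l where "l \<subseteq> P \<inter> Q" "vec.dim l = 1"
    by (auto simp: one_dim_subspaces_def)
  then have "l \<subseteq> {0}" "vec.dim l = 1"
    using inter_member[OF assms] by auto
  then show False
    using vec.dim_eq_0[of l] by simp
qed

text \<open>The nonzero vectors of the space are distributed over the members,
  \<open>q ^ 2 - 1\<close> to each.\<close>

lemma card_spread: "card S = (CARD('a))\<^sup>2 + 1"
proof -
  let ?q = "CARD('a)"
  have "(UNIV :: ('a ^ 4) set) - {0} = (\<Union>P\<in>S. P - {0})"
    using Union_members by blast
  then have "card ((UNIV :: ('a ^ 4) set) - {0}) = card (\<Union>P\<in>S. P - {0})"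
    by simp
  also have "\<dots> = (\<Sum>P\<in>S. card (P - {0}))"
  proof (rule card_UN_disjoint)
    show "\<forall>P\<in>S. \<forall>Q\<in>S. P \<noteq> Q \<longrightarrow> (P - {0}) \<inter> (Q - {0}) = {}"
      using inter_member by blast
  qed auto
  also have "\<dots> = (\<Sum>P\<in>S. ?q\<^sup>2 - 1)"
  proof (rule sum.cong)
    fix P assume "P \<in> S"
    then show "card (P - {0}) = ?q\<^sup>2 - 1"
      using card_subspace_vec[OF subspace_member] dim_member vec.subspace_0[OF subspace_member]
      by (simp add: card_Diff_singleton)
  qed simp
  finally have "card S * (?q\<^sup>2 - 1) = ?q ^ 4 - 1"
    by (simp add: card_Diff_singleton)
  moreover have "?q ^ 4 - 1 = (?q\<^sup>2 + 1) * (?q\<^sup>2 - 1)"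
    by (simp add: diff_mult_distrib2 power2_eq_square power4_eq_xxxx algebra_simps)
  moreover have "?q\<^sup>2 - 1 \<noteq> 0"
    using CARD_field_ge_2[where 'a='a] power_increasing[of 1 2 ?q] by simp
  ultimately show ?thesis
    by (simp only: mult_cancel2) simp
qed

end

section \<open>Analysis of the algorithm\<close>

locale algorithm = spread S
  for S :: "('a::{field,finite} ^ 4) set set" +
  fixes u :: "nat \<Rightarrow> nat \<Rightarrow> 'a ^ 4" and M :: "nat \<Rightarrow> ('a ^ 4) set set set"
  assumes M_0: "M 0 = one_dim_subspaces ` S"
    and step: "\<And>i. 1 \<le> i \<Longrightarrow> (\<And>j. j < i \<Longrightarrow> M j \<noteq> {}) \<Longrightarrow>
      \<exists>A\<in>M (i - 1). admissible_choice A (u i) \<and> M i = trim u i (M (i - 1) - {A})"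
begin

text \<open>The spread element used in round \<open>i\<close>, recovered from the vectors: a run
  does not record the chosen set \<open>A\<close>, which moreover may already have lost
  lines.\<close>

definition plane :: "nat \<Rightarrow> ('a ^ 4) set" where
  "plane i = vec.span {u i 1, u i 2}"

definition removed_upto :: "nat \<Rightarrow> ('a ^ 4) set set" where
  "removed_upto i = (\<Union>j\<in>{1..i}. removed u j)"

text \<open>Only removals up to round \<open>i - 1\<close> are excluded, because a round chooses its
  vectors before it trims.\<close>

definition round_ok :: "nat \<Rightarrow> bool" where
  "round_ok i \<longleftrightarrow> plane i \<in> S - plane ` {1..<i} \<and> u i 0 = u i 1 - u i 2 \<and>
     (\<forall>a\<in>{0,1,2}. vec.span {u i a} \<in> one_dim_subspaces (plane i) - removed_upto (i - 1)) \<and>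
     vec.span {u i 1} \<noteq> vec.span {u i 2}"

lemma plane_eq:
  assumes P: "P \<in> S" and a: "vec.span {u i 1} \<in> one_dim_subspaces P"
    "vec.span {u i 2} \<in> one_dim_subspaces P" "vec.span {u i 1} \<noteq> vec.span {u i 2}"
  shows "plane i = P"
proof -
  have sub: "u i 1 \<in> P" "u i 2 \<in> P"
    using a vec.span_base[of "u i 1" "{u i 1}"] vec.span_base[of "u i 2" "{u i 2}"]
    by (auto simp: one_dim_subspaces_def)
  then have le: "plane i \<subseteq> P"
    using subspace_member[OF P] by (simp add: plane_def vec.span_minimal)
  have ne: "u i 1 \<noteq> 0" "u i 2 \<noteq> 0"
    using a(1,2) by (auto simp: one_dim_subspaces_def)
  have "u i 1 \<notin> vec.span {u i 2}"
    using span_single_eq[of "u i 1" "u i 2"] ne a(3) by blast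
  then have "vec.independent {u i 1, u i 2}"
    using ne by (simp add: vec.independent_insert)
  moreover have "u i 1 \<noteq> u i 2"
    using a(3) by auto
  ultimately have "vec.dim (plane i) = 2"
    unfolding plane_def by (simp add: vec.dim_span_eq_card_independent del: vec.dim_span)
  then have "card (plane i) = card P"
    using card_subspace_vec[OF subspace_member[OF P]] dim_member[OF P]
      card_subspace_vec[OF vec.subspace_span[of "{u i 1, u i 2}"]] by (simp add: plane_def)
  then show ?thesis
    using le by (intro card_subset_eq) auto
qed

lemma run_invariant:
  assumes "\<And>j. j < i \<Longrightarrow> M j \<noteq> {}"
  shows "(\<forall>j\<in>{1..i}. round_ok j) \<and>
    M i = {B. \<exists>P\<in>S - plane ` {1..i}. B = one_dim_subspaces P - removed_upto i \<and> 3 \<le> card B}"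
  using assms
proof (induction i)
  case 0
  have "3 \<le> card (one_dim_subspaces P)" if "P \<in> S" for P
    using card_lines[OF that] CARD_field_ge_2[where 'a='a] by simp
  then show ?case
    by (auto simp: M_0 removed_upto_def)
next
  case (Suc i)
  let ?line = "\<lambda>P. one_dim_subspaces P - removed_upto i"
  have rounds: "\<forall>j\<in>{1..i}. round_ok j"
    and M_i: "M i = {B. \<exists>P\<in>S - plane ` {1..i}. B = ?line P \<and> 3 \<le> card B}"
    using Suc by (metis less_Suc_eq)+
  obtain A where A: "A \<in> M i" "admissible_choice A (u (Suc i))" "M (Suc i) = trim u (Suc i) (M i - {A})"
    using step[of "Suc i"] Suc.prems by auto
  obtain P where P: "P \<in> S" "P \<notin> plane ` {1..i}" "A = ?line P" "3 \<le> card A"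
    using A(1) unfolding M_i by blast
  have adm: "\<forall>a\<in>{0,1,2}. vec.span {u (Suc i) a} \<in> A" "vec.span {u (Suc i) 1} \<noteq> vec.span {u (Suc i) 2}"
    "u (Suc i) 0 = u (Suc i) 1 - u (Suc i) 2"
    using A(2) unfolding admissible_choice_def by blast+
  have plane: "plane (Suc i) = P"
    by (rule plane_eq[OF P(1)]) (use adm P(3) in auto)
  have "round_ok (Suc i)"
    unfolding round_ok_def plane using adm P by (auto simp: atLeastLessThanSuc_atLeastAtMost)
  then have rounds': "\<forall>j\<in>{1..Suc i}. round_ok j"
    using rounds by (auto simp: le_Suc_eq)
  have removed_Suc: "removed_upto (Suc i) = removed_upto i \<union> removed u (Suc i)"
    by (simp add: removed_upto_def atLeastAtMostSuc_conv Un_commute)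
  \<comment> \<open>Surviving sets are nonempty and lines of different spread elements are disjoint,
    so discarding the set \<open>A\<close> discards exactly the spread element
    \<open>P\<close>.\<close>
  have same_iff: "B = A \<longleftrightarrow> Q = P" if "Q \<in> S" "B = ?line Q" "3 \<le> card B" for B Q
  proof
    assume "B = A"
    have "B \<noteq> {}"
      using that(3) by auto
    then show "Q = P"
      using lines_disjoint[OF that(1) P(1)] \<open>B = A\<close> P(3) that(2) by blast
  qed (use that P in simp)
  have unused_Suc: "S - plane ` {1..Suc i} = S - plane ` {1..i} - {P}"
    by (auto simp: plane atLeastAtMostSuc_conv)
  have rest: "M i - {A} = {B. \<exists>Q\<in>S - plane ` {1..Suc i}. B = ?line Q \<and> 3 \<le> card B}"
    unfolding M_i unused_Suc
  proof (intro subset_antisym subsetI)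
    fix B assume "B \<in> {B. \<exists>P\<in>S - plane ` {1..i}. B = ?line P \<and> 3 \<le> card B} - {A}"
    then obtain Q where "Q \<in> S - plane ` {1..i}" "B = ?line Q" "3 \<le> card B" "B \<noteq> A"
      by blast
    moreover from this have "Q \<noteq> P"
      using same_iff by blast
    ultimately show "B \<in> {B. \<exists>Q\<in>S - plane ` {1..i} - {P}. B = ?line Q \<and> 3 \<le> card B}"
      by blast
  next
    fix B assume "B \<in> {B. \<exists>Q\<in>S - plane ` {1..i} - {P}. B = ?line Q \<and> 3 \<le> card B}"
    then obtain Q where "Q \<in> S - plane ` {1..i}" "B = ?line Q" "3 \<le> card B" "Q \<noteq> P"
      by blast
    moreover from this have "B \<noteq> A"
      using same_iff[of Q B] by blast
    ultimately show "B \<in> {B. \<exists>P\<in>S - plane ` {1..i}. B = ?line P \<and> 3 \<le> card B} - {A}"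
      by blast
  qed
  have "M (Suc i) = {B' \<in> (\<lambda>B. B - removed u (Suc i)) ` (M i - {A}). card B' \<ge> 3}"
  proof (cases "1 \<le> i")
    case True
    then show ?thesis
      unfolding A(3) trim_def by auto
  next
    case False
    \<comment> \<open>In the first round nothing is trimmed; since nothing is removed and every set
      already has three elements, the trimmed form describes the family all the same.\<close>
    then have "removed u (Suc i) = {}"
      by (simp add: removed_def)
    moreover have "card B \<ge> 3" if "B \<in> M i - {A}" for B
      using that unfolding rest by blast
    ultimately show ?thesis
      unfolding A(3) trim_def using False by auto
  qed
  also have "\<dots> = {B. \<exists>Q\<in>S - plane ` {1..Suc i}. B = one_dim_subspaces Q - removed_upto (Suc i) \<and> 3 \<le> card B}"
  proof (intro subset_antisym subsetI)
    fix B assume "B \<in> {B' \<in> (\<lambda>B. B - removed u (Suc i)) ` (M i - {A}). card B' \<ge> 3}"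
    then obtain Q where "Q \<in> S - plane ` {1..Suc i}" "B = ?line Q - removed u (Suc i)" "3 \<le> card B"
      unfolding rest by blast
    then show "B \<in> {B. \<exists>Q\<in>S - plane ` {1..Suc i}. B = one_dim_subspaces Q - removed_upto (Suc i) \<and> 3 \<le> card B}"
      unfolding removed_Suc by blast
  next
    fix B assume "B \<in> {B. \<exists>Q\<in>S - plane ` {1..Suc i}. B = one_dim_subspaces Q - removed_upto (Suc i) \<and> 3 \<le> card B}"
    then obtain Q where Q: "Q \<in> S - plane ` {1..Suc i}" "B = ?line Q - removed u (Suc i)" "3 \<le> card B"
      unfolding removed_Suc by blast
    \<comment> \<open>A set with three elements after this trimming had them before, so it had not
      been deleted earlier.\<close>
    then have "3 \<le> card (?line Q)"
      using card_mono[of "?line Q" B] by fastforce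
    then show "B \<in> {B' \<in> (\<lambda>B. B - removed u (Suc i)) ` (M i - {A}). card B' \<ge> 3}"
      unfolding rest using Q by blast
  qed
  finally show ?case
    using rounds' by blast
qed

lemma inj_on_plane:
  assumes "\<And>i. i \<in> I \<Longrightarrow> 1 \<le> i \<and> round_ok i"
  shows "inj_on plane I"
proof (rule linorder_inj_onI)
  fix i j assume "i < j" "i \<in> I" "j \<in> I"
  then have "plane j \<notin> plane ` {1..<j}" "i \<in> {1..<j}"
    using assms[of i] assms[of j] unfolding round_ok_def by auto
  then show "plane i \<noteq> plane j"
    by (metis image_eqI)
qed auto

text \<open>Every round uses up a new element of the finite spread.\<close>

lemma terminates: "\<exists>L. M L = {}"
proof (rule ccontr)
  assume "\<not> (\<exists>L. M L = {})"
  then have "\<forall>j\<in>{1..i}. round_ok j" for i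
    by (intro conjunct1[OF run_invariant]) blast
  then have ok: "round_ok i" if "1 \<le> i" for i
    using that by (meson atLeastAtMost_iff order_refl)
  have "inj_on plane {1..}"
    by (rule inj_on_plane) (use ok in simp)
  moreover have "plane ` {1..} \<subseteq> S"
    using ok by (auto simp: round_ok_def)
  then have "finite (plane ` {1..})"
    by (rule finite_subset) simp
  ultimately have "finite {1 :: nat..}"
    by (rule finite_imageD[rotated])
  then show False
    by (simp add: infinite_Ici)
qed

end

lemma card_UN_le_mult:
  assumes "\<And>i. i \<in> I \<Longrightarrow> card (F i) \<le> c" "finite I"
  shows "card (\<Union>i\<in>I. F i) \<le> card I * c"
  using card_UN_le[OF assms(2), of F] sum_bounded_above[of I "\<lambda>i. card (F i)" c] assms(1) by simp

section \<open>Geometry of a finished run and the lower bound on the number of rounds\<close>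

locale finished_algorithm = algorithm +
  fixes L :: nat
  assumes finished: "M L = {}" and running: "\<And>i. i < L \<Longrightarrow> M i \<noteq> {}"
begin

lemma round_ok: "i \<in> {1..L} \<Longrightarrow> round_ok i"
  using conjunct1[OF run_invariant[of L, OF running]] by blast

lemma round:
  assumes "i \<in> {1..L}"
  shows "plane i \<in> S" "u i 0 = u i 1 - u i 2" "vec.span {u i 1} \<noteq> vec.span {u i 2}"
    "\<And>a. a \<in> {0,1,2} \<Longrightarrow> vec.span {u i a} \<in> one_dim_subspaces (plane i)"
    "\<And>a. a \<in> {0,1,2} \<Longrightarrow> vec.span {u i a} \<notin> removed_upto (i - 1)"
  using round_ok[OF assms] unfolding round_ok_def by blast+

lemma inj_plane: "inj_on plane {1..L}"
  by (rule inj_on_plane) (use round_ok in simp)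

lemma u_nonzero:
  assumes "i \<in> {1..L}" "a \<in> {0,1,2}"
  shows "u i a \<noteq> 0"
proof
  assume "u i a = 0"
  then have "vec.dim (vec.span {u i a}) = 0"
    by simp
  then show False
    using round(4)[OF assms] unfolding one_dim_subspaces_def by simp
qed

lemma plane_inter:
  assumes i: "i \<in> {1..L}" and j: "j \<in> {1..L}" and "i \<noteq> j"
  shows "plane i \<inter> plane j = {0}"
proof (rule inter_member[OF round(1)[OF i] round(1)[OF j]])
  show "plane i \<noteq> plane j"
    using inj_onD[OF inj_plane _ i j] \<open>i \<noteq> j\<close> by blast
qed

lemma u_independent:
  assumes i: "i \<in> {1..L}" and eq: "\<alpha> *s u i 1 + \<beta> *s u i 2 = 0"
  shows "\<alpha> = 0 \<and> \<beta> = 0"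
proof -
  have "\<alpha> = 0"
  proof (rule ccontr)
    assume "\<alpha> \<noteq> 0"
    have "\<alpha> *s u i 1 = (- \<beta>) *s u i 2"
      using eq by (simp add: eq_neg_iff_add_eq_0 vec.scale_minus_left)
    then have "inverse \<alpha> *s (\<alpha> *s u i 1) = inverse \<alpha> *s ((- \<beta>) *s u i 2)"
      by simp
    then have "u i 1 = (inverse \<alpha> * (- \<beta>)) *s u i 2"
      using \<open>\<alpha> \<noteq> 0\<close> by (simp add: vector_smult_assoc)
    then have "u i 1 \<in> vec.span {u i 2}"
      unfolding vec.span_singleton by blast
    then show False
      using span_single_eq[of "u i 1" "u i 2"] u_nonzero[OF i] round(3)[OF i] by simp
  qed
  then show ?thesis
    using eq u_nonzero[OF i, of 2] by simp
qed

text \<open>The lines of \<open>span {u i a, u j b}\<close> are removed in the later of the rounds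
  \<open>i\<close> and \<open>j\<close>, which precedes the choice in round
  \<open>l\<close>.\<close>

lemma u_not_in_span:
  assumes "i \<in> {1..L}" "j \<in> {1..L}" "l \<in> {1..L}" "i < l" "j < l" "i \<noteq> j"
    and a: "a \<in> {0,1,2}" "b \<in> {0,1,2}" "c \<in> {0,1,2}"
  shows "u l c \<notin> vec.span {u i a, u j b}"
proof -
  have *: "u l c \<notin> vec.span {u i a, u j b}" if "i \<in> {1..L}" "j \<in> {1..L}" "i < l" "j < i"
    "a \<in> {0,1,2}" "b \<in> {0,1,2}" for i j a b
  proof
    assume "u l c \<in> vec.span {u i a, u j b}"
    then have "vec.span {u l c} \<in> one_dim_subspaces (vec.span {u i a, u j b})"
      using u_nonzero assms(3) a(3) by (intro span_single_in_one_dim_subspaces) auto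
    moreover have "j \<in> {1..i - 1}" "i \<in> {1..l - 1}"
      using that by auto
    ultimately have "vec.span {u l c} \<in> removed_upto (l - 1)"
      unfolding removed_upto_def removed_def using that(5,6) by blast
    then show False
      using round(5)[OF assms(3) a(3)] by blast
  qed
  show ?thesis
  proof (cases "j < i")
    case True
    then show ?thesis
      using * assms by blast
  next
    case False
    then show ?thesis
      using *[of j i b a] assms by (simp add: insert_commute)
  qed
qed

text \<open>Among the at most \<open>q + 1\<close> points of the span, the two generating ones are
  distinct and lie in chosen spread elements, hence outside \<open>X\<close>.\<close>

lemma card_removed_span:
  assumes i: "i \<in> {1..L}" "j \<in> {1..L}" "i \<noteq> j" and a: "a \<in> {0,1,2}" "b \<in> {0,1,2}"
    and X: "X = (\<Union>P\<in>S - plane ` {1..L}. one_dim_subspaces P)"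
  shows "card (one_dim_subspaces (vec.span {u i a, u j b}) \<inter> X) \<le> CARD('a) - 1"
proof -
  let ?V = "vec.span {u i a, u j b}"
  let ?l = "vec.span {u i a}" and ?m = "vec.span {u j b}"
  have lm: "?l \<in> one_dim_subspaces (plane i)" "?m \<in> one_dim_subspaces (plane j)"
    using round(4) i a by blast+
  have ij: "plane i \<noteq> plane j" "plane i \<in> S" "plane j \<in> S"
    using inj_onD[OF inj_plane _ i(1,2)] i(3) round(1)[OF i(1)] round(1)[OF i(2)] by blast+
  have "?l \<noteq> ?m"
    using lm lines_disjoint[OF ij(2,3,1)] by (metis IntI empty_iff)
  have lmV: "?l \<in> one_dim_subspaces ?V" "?m \<in> one_dim_subspaces ?V"
    by (intro span_single_in_one_dim_subspaces vec.subspace_span vec.span_base u_nonzero i a; simp)+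
  have notX: "k \<notin> X" if "k \<in> one_dim_subspaces (plane t)" "t \<in> {1..L}" for k t
  proof
    assume "k \<in> X"
    then obtain P where "P \<in> S" "P \<notin> plane ` {1..L}" "k \<in> one_dim_subspaces P"
      unfolding X by blast
    then show False
      using lines_disjoint[of P "plane t"] round(1)[OF that(2)] that by blast
  qed
  have "vec.dim ?V \<le> card {u i a, u j b}"
    by (rule vec.dim_le_card) auto
  also have "\<dots> \<le> 2"
    by (simp add: card_insert_if)
  finally have "card (one_dim_subspaces ?V) \<le> CARD('a) + 1"
    by (rule card_one_dim_subspaces_plane(2)[OF vec.subspace_span])
  then have "card (one_dim_subspaces ?V - {?l, ?m}) \<le> CARD('a) - 1"
    using lmV \<open>?l \<noteq> ?m\<close> by (simp add: card_Diff_subset)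
  moreover have "card (one_dim_subspaces ?V \<inter> X) \<le> card (one_dim_subspaces ?V - {?l, ?m})"
  proof (rule card_mono)
    show "one_dim_subspaces ?V \<inter> X \<subseteq> one_dim_subspaces ?V - {?l, ?m}"
      using notX[OF lm(1) i(1)] notX[OF lm(2) i(2)] by blast
  qed simp
  ultimately show ?thesis
    by linarith
qed

text \<open>
  Each of the spread elements that were never chosen has lost at least \<open>q - 1\<close> of its \<open>q + 1\<close> points,
  while each of the \<open>9 * L * (L - 1) / 2\<close> removed lines of the projective space contains only
  \<open>q - 1\<close> points outside the chosen spread elements.
\<close>

lemma rounds_lower_bound: "2 * ((CARD('a))\<^sup>2 + 1) \<le> 2 * L + 9 * (L * (L - 1))"
proof -
  let ?q = "CARD('a)"
  define U where "U = S - plane ` {1..L}"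
  define X where "X = (\<Union>P\<in>U. one_dim_subspaces P)"
  define T where "T = (\<lambda>i j a b. one_dim_subspaces (vec.span {u i a, u j b}) \<inter> X)"
  have card_012: "card {0,1,2::nat} = 3"
    by simp
  have "card (plane ` {1..L}) = L"
    using card_image[OF inj_plane] by simp
  moreover have "plane ` {1..L} \<subseteq> S"
    using round(1) by blast
  ultimately have cU: "card U = card S - L"
    unfolding U_def by (simp add: card_Diff_subset)
  have lost: "?q - 1 \<le> card (one_dim_subspaces P \<inter> removed_upto L)" if "P \<in> U" for P
  proof -
    let ?B = "one_dim_subspaces P - removed_upto L"
    have "{} = {B. \<exists>P\<in>U. B = one_dim_subspaces P - removed_upto L \<and> 3 \<le> card B}"
      using conjunct2[OF run_invariant[of L, OF running]] unfolding finished U_def .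
    then have "\<not> 3 \<le> card ?B"
      using that by blast
    moreover have "card (one_dim_subspaces P) = card (one_dim_subspaces P \<inter> removed_upto L) + card ?B"
      using card_Un_disjoint[of "one_dim_subspaces P \<inter> removed_upto L" ?B] by (simp add: Int_Diff_Un Int_Diff_disjoint)
    moreover have "card (one_dim_subspaces P) = ?q + 1"
      using card_lines that by (simp add: U_def)
    ultimately show ?thesis
      by linarith
  qed
  have "card U * (?q - 1) = (\<Sum>P\<in>U. ?q - 1)"
    by simp
  also have "\<dots> \<le> (\<Sum>P\<in>U. card (one_dim_subspaces P \<inter> removed_upto L))"
    by (rule sum_mono) (rule lost)
  also have "\<dots> = card (\<Union>P\<in>U. one_dim_subspaces P \<inter> removed_upto L)"
  proof (rule card_UN_disjoint[symmetric])
    show "\<forall>P\<in>U. \<forall>Q\<in>U. P \<noteq> Q \<longrightarrow>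
      (one_dim_subspaces P \<inter> removed_upto L) \<inter> (one_dim_subspaces Q \<inter> removed_upto L) = {}"
      using lines_disjoint unfolding U_def by blast
  qed auto
  also have "(\<Union>P\<in>U. one_dim_subspaces P \<inter> removed_upto L) =
      (\<Union>i\<in>{1..L}. \<Union>j\<in>{1..i-1}. \<Union>a\<in>{0,1,2}. \<Union>b\<in>{0,1,2}. T i j a b)"
    unfolding T_def X_def removed_upto_def removed_def by blast
  also have "card \<dots> \<le> (\<Sum>i\<in>{1..L}. (i - 1) * (9 * (?q - 1)))"
  proof (rule order_trans[OF card_UN_le sum_mono])
    fix i assume i: "i \<in> {1..L}"
    have "card (\<Union>j\<in>{1..i-1}. \<Union>a\<in>{0,1,2}. \<Union>b\<in>{0,1,2}. T i j a b) \<le> card {1..i-1} * (9 * (?q - 1))"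
    proof (rule card_UN_le_mult)
      fix j assume j: "j \<in> {1..i-1}"
      have "card (\<Union>a\<in>{0,1,2}. \<Union>b\<in>{0,1,2}. T i j a b) \<le> card {0,1,2::nat} * (3 * (?q - 1))"
      proof (rule card_UN_le_mult)
        fix a :: nat assume a: "a \<in> {0,1,2}"
        have "card (\<Union>b\<in>{0,1,2}. T i j a b) \<le> card {0,1,2::nat} * (?q - 1)"
        proof (rule card_UN_le_mult)
          fix b :: nat assume b: "b \<in> {0,1,2}"
          show "card (T i j a b) \<le> ?q - 1"
            unfolding T_def
          proof (rule card_removed_span[OF i _ _ a b])
            show "j \<in> {1..L}" "i \<noteq> j"
              using i j by auto
          qed (simp add: X_def U_def)
        qed simp
        then show "card (\<Union>b\<in>{0,1,2}. T i j a b) \<le> 3 * (?q - 1)"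
          by (simp only: card_012)
      qed simp
      then show "card (\<Union>a\<in>{0,1,2}. \<Union>b\<in>{0,1,2}. T i j a b) \<le> 9 * (?q - 1)"
        by (simp only: card_012)
    qed simp
    then show "card (\<Union>j\<in>{1..i-1}. \<Union>a\<in>{0,1,2}. \<Union>b\<in>{0,1,2}. T i j a b) \<le> (i - 1) * (9 * (?q - 1))"
      by (simp only: card_atLeastAtMost) simp
  qed simp
  also have "\<dots> = 9 * (\<Sum>i\<in>{1..L}. i - 1) * (?q - 1)"
    by (simp only: sum_distrib_right[symmetric] ac_simps)
  \<comment> \<open>The factor \<open>q - 1\<close> occurs on both sides: as the loss per spread
    element and as the yield per removed span.\<close>
  finally have "card U \<le> 9 * (\<Sum>i\<in>{1..L}. i - 1)"
    using CARD_field_ge_2[where 'a='a] unfolding mult_le_cancel2 by linarith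
  moreover have "2 * (\<Sum>i\<in>{1..L}. i - 1) = L * (L - 1)"
    by (induction L) (auto simp: algebra_simps)
  \<comment> \<open>With variables in place of the products this is linear, including the truncated
    subtraction \<open>card S - L\<close>.\<close>
  moreover have "2 * (c + 1) \<le> 2 * l + 9 * t" if "x - l \<le> 9 * s" "2 * s = t" "x = c + 1" for c l s t x :: nat
    using that by presburger
  ultimately show ?thesis
    using cU card_spread by metis
qed

end

section \<open>The code of a run\<close>

lemma span_pairE:
  fixes y :: "'a::field ^ 'n"
  assumes "y \<in> vec.span {v, w}"
  obtains a b where "y = a *s v + b *s w"
proof -
  obtain a where "y - a *s v \<in> vec.span {w}"
    using assms unfolding vec.span_insert by blast
  then obtain b where "y - a *s v = b *s w"
    unfolding vec.span_singleton by blast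
  then have "y = a *s v + b *s w"
    by (simp add: algebra_simps)
  then show ?thesis
    by (rule that)
qed

text \<open>Triples are numbered from 1; for these, \<open>(j + 2) div 3\<close> recovers the number
  from a coordinate.\<close>

definition block :: "nat \<Rightarrow> nat set" where
  "block i = {3 * i - 2, 3 * i - 1, 3 * i}"

lemma in_block_iff: "1 \<le> i \<Longrightarrow> j \<in> block i \<longleftrightarrow> (j + 2) div 3 = i"
  unfolding block_def insert_iff empty_iff by presburger

lemma card_block: "1 \<le> i \<Longrightarrow> card (block i) = 3"
  by (auto simp: block_def card_insert_if)

lemma finite_block: "finite (block i)"
  by (simp add: block_def)

lemma block_disjoint:
  assumes "1 \<le> i" "1 \<le> j" "i \<noteq> j"
  shows "block i \<inter> block j = {}"
proof (rule equals0I)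
  fix k assume "k \<in> block i \<inter> block j"
  then show False
    using in_block_iff[OF assms(1), of k] in_block_iff[OF assms(2), of k] assms(3) by simp
qed

lemma Union_blocks: "(\<Union>i\<in>{1..L}. block i) = {1..3 * L}"
proof (intro subset_antisym subsetI)
  fix j assume "j \<in> {1..3 * L}"
  then have "(j + 2) div 3 \<in> {1..L}"
    by auto
  moreover from this have "j \<in> block ((j + 2) div 3)"
    using in_block_iff by simp
  ultimately show "j \<in> (\<Union>i\<in>{1..L}. block i)"
    by blast
qed (auto simp: block_def)

lemma sum_block:
  fixes x :: "nat \<Rightarrow> 'a::comm_monoid_add"
  assumes "1 \<le> i"
  shows "(\<Sum>j\<in>block i. x j) = x (3 * i - 2) + (x (3 * i - 1) + x (3 * i))"
proof -
  have "3 * i - 2 \<noteq> 3 * i - 1" "3 * i - 2 \<noteq> 3 * i" "3 * i - 1 \<noteq> 3 * i"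
    using assms by linarith+
  then show ?thesis
    by (simp add: block_def)
qed

lemma partition_blocks: "partition_on {1..3 * L} (block ` {1..L})"
proof (rule partition_onI)
  show "\<Union>(block ` {1..L}) = {1..3 * L}"
    by (rule Union_blocks)
  show "disjnt p p'" if "p \<in> block ` {1..L}" "p' \<in> block ` {1..L}" "p \<noteq> p'" for p p'
    using that block_disjoint unfolding disjnt_def by fastforce
  show "{} \<notin> block ` {1..L}"
    by (auto simp: block_def)
qed

lemma card_blocks: "card (block ` {1..L}) = L"
proof -
  have "inj_on block {1..L}"
  proof (rule inj_onI)
    fix i j assume "i \<in> {1..L}" "j \<in> {1..L}" and eq: "block i = block j"
    have "3 * i \<in> block i"
      by (simp add: block_def)
    moreover have "1 \<le> i" "1 \<le> j"
      using \<open>i \<in> {1..L}\<close> \<open>j \<in> {1..L}\<close> by simp_all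
    ultimately show "i = j"
      using block_disjoint[of i j] eq by blast
  qed
  then show ?thesis
    by (simp add: card_image)
qed

context finished_algorithm
begin

definition D :: "(nat \<Rightarrow> 'a) set" where
  "D = parity_words {1..3 * L} (block ` {1..L}) (\<lambda>_. 1)"

text \<open>The coordinates of triple \<open>i\<close> carry the columns \<open>0\<close>,
  \<open>u i 1\<close>, \<open>u i 2\<close> of a parity-check matrix. Their pairwise differences
  are, up to sign, \<open>u i 1\<close>, \<open>u i 2\<close> and \<open>u i 0\<close>, which is why
  the algorithm also keeps \<open>u i 0\<close> in general position.\<close>

definition contribution :: "(nat \<Rightarrow> 'a) \<Rightarrow> nat \<Rightarrow> 'a ^ 4" where
  "contribution x i = x (3 * i - 1) *s u i 1 + x (3 * i) *s u i 2"

definition code :: "(nat \<Rightarrow> 'a) set" where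
  "code = {x \<in> D. (\<Sum>i\<in>{1..L}. contribution x i) = 0}"

lemma D_outside: "x \<in> D \<Longrightarrow> j \<notin> {1..3 * L} \<Longrightarrow> x j = 0"
  unfolding D_def parity_words_def by blast

lemma D_sum: "x \<in> D \<Longrightarrow> i \<in> {1..L} \<Longrightarrow> x (3 * i - 2) + (x (3 * i - 1) + x (3 * i)) = 0"
  using sum_block[of i x] unfolding D_def parity_words_def by simp

lemma D_I:
  assumes "\<And>j. j \<notin> {1..3 * L} \<Longrightarrow> x j = 0"
    "\<And>i. i \<in> {1..L} \<Longrightarrow> x (3 * i - 2) + (x (3 * i - 1) + x (3 * i)) = 0"
  shows "x \<in> D"
  unfolding D_def parity_words_def using assms sum_block[of _ x] by simp

lemma subspace_D: "word.subspace D"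
  unfolding D_def by (rule subspace_parity_words)

lemma finite_D: "finite D"
  unfolding D_def by (rule finite_parity_words) simp

lemma card_D: "card D = CARD('a) ^ (2 * L)"
  unfolding D_def by (rule card_parity_words_triples[OF partition_blocks card_blocks]) simp

lemma contribution_add: "contribution (x + y) i = contribution x i + contribution y i"
  by (simp add: contribution_def vec.scale_left_distrib)

lemma contribution_scale: "contribution (scale_word c x) i = c *s contribution x i"
  by (simp add: contribution_def scale_word_def vec.scale_right_distrib)

lemma subspace_code: "word.subspace code"
proof (rule word.subspaceI)
  show "0 \<in> code"
    using word.subspace_0[OF subspace_D] by (simp add: code_def contribution_def)
  show "x + y \<in> code" if "x \<in> code" "y \<in> code" for x y
    using that word.subspace_add[OF subspace_D] by (simp add: code_def contribution_add sum.distrib)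
  show "scale_word c x \<in> code" if "x \<in> code" for c x
    using that word.subspace_scale[OF subspace_D]
    by (simp add: code_def contribution_scale flip: vec.scale_sum_right)
qed

lemma code_words: "code \<subseteq> words (3 * L)"
  using D_outside unfolding code_def words_def by blast

text \<open>\<open>D\<close> is parametrised by the last two entries of every triple; the zero sum
  fixes the first one.\<close>

lemma word_with_coefficients:
  fixes a b :: "nat \<Rightarrow> 'a"
  obtains x where "x \<in> D" "\<And>i. i \<in> {1..L} \<Longrightarrow> x (3 * i - 2) = - a i - b i"
    "\<And>i. i \<in> {1..L} \<Longrightarrow> x (3 * i - 1) = a i" "\<And>i. i \<in> {1..L} \<Longrightarrow> x (3 * i) = b i"
proof -
  define x where "x = (\<lambda>j. if j \<in> {1..3 * L} then
    (let i = (j + 2) div 3 in if j = 3 * i then b i else if j = 3 * i - 1 then a i else - a i - b i) else 0)"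
  have x: "x (3 * i - 2) = - a i - b i" "x (3 * i - 1) = a i" "x (3 * i) = b i" if "i \<in> {1..L}" for i
  proof -
    have "1 \<le> i" "i \<le> L"
      using that by auto
    then have mem: "3 * i - 2 \<in> {1..3 * L}" "3 * i - 1 \<in> {1..3 * L}" "3 * i \<in> {1..3 * L}"
      by auto
    have quot: "(3 * i - 2 + 2) div 3 = i" "(3 * i - 1 + 2) div 3 = i" "(3 * i + 2) div 3 = i"
      using in_block_iff[OF \<open>1 \<le> i\<close>] by (simp_all add: block_def)
    have ne: "3 * i - 2 \<noteq> 3 * i" "3 * i - 2 \<noteq> 3 * i - 1" "3 * i - 1 \<noteq> 3 * i"
      using \<open>1 \<le> i\<close> by linarith+
    show "x (3 * i - 2) = - a i - b i" "x (3 * i - 1) = a i" "x (3 * i) = b i"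
      unfolding x_def Let_def quot using mem ne by simp_all
  qed
  have "x \<in> D"
  proof (rule D_I)
    show "x j = 0" if "j \<notin> {1..3 * L}" for j
      unfolding x_def by (rule if_not_P[OF that])
    show "x (3 * i - 2) + (x (3 * i - 1) + x (3 * i)) = 0" if "i \<in> {1..L}" for i
      unfolding x[OF that] by simp
  qed
  then show ?thesis
    using that x by blast
qed

text \<open>Two spread elements meet only in 0, so their sum has \<open>q ^ 2 * q ^ 2\<close>
  elements and is the whole space.\<close>

lemma two_planes_generate:
  assumes "2 \<le> L"
  obtains a b where "(\<Sum>i\<in>{1,2}. a i *s u i 1 + b i *s u i 2) = (y :: 'a ^ 4)"
proof -
  have mem: "1 \<in> {1..L}" "2 \<in> {1..L}"
    using assms by auto
  let ?f = "\<lambda>(v, w). v + w"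
  have "inj_on ?f (plane 1 \<times> plane 2)"
  proof (rule inj_onI, clarify)
    fix v w v' w' assume v: "v \<in> plane 1" "v' \<in> plane 1" and w: "w \<in> plane 2" "w' \<in> plane 2"
      and eq: "v + w = v' + w'"
    have "v - v' = w' - w"
      using eq by (simp add: algebra_simps)
    moreover have "v - v' \<in> plane 1" "w' - w \<in> plane 2"
      using v w unfolding plane_def by (simp_all add: vec.span_diff)
    ultimately have "v - v' \<in> plane 1 \<inter> plane 2"
      by simp
    then have "v - v' \<in> {0}"
      by (subst (asm) plane_inter[OF mem]) simp_all
    then show "v = v' \<and> w = w'"
      using eq by simp
  qed
  then have "card (?f ` (plane 1 \<times> plane 2)) = card (plane 1) * card (plane 2)"
    by (simp add: card_image card_cartesian_product)
  moreover have "card (plane i) = CARD('a)\<^sup>2" if "i \<in> {1..L}" for i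
    using card_subspace_vec[OF subspace_member] dim_member round(1)[OF that] by metis
  ultimately have "card (?f ` (plane 1 \<times> plane 2)) = CARD('a)\<^sup>2 * CARD('a)\<^sup>2"
    using mem by metis
  also have "\<dots> = CARD('a ^ 4)"
    by (simp flip: power_add)
  finally have "?f ` (plane 1 \<times> plane 2) = UNIV"
    by (intro card_subset_eq) simp_all
  then have "y \<in> ?f ` (plane 1 \<times> plane 2)"
    by (rule ssubst) (rule UNIV_I)
  then obtain v w where vw: "v \<in> plane 1" "w \<in> plane 2" "y = v + w"
    by auto
  obtain a1 b1 where v: "v = a1 *s u 1 1 + b1 *s u 1 2"
    using vw(1) unfolding plane_def by (rule span_pairE)
  obtain a2 b2 where w: "w = a2 *s u 2 1 + b2 *s u 2 2"
    using vw(2) unfolding plane_def by (rule span_pairE)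
  show ?thesis
    by (rule that[of "\<lambda>i. if i = 1 then a1 else a2" "\<lambda>i. if i = 1 then b1 else b2"]) (simp add: vw(3) v w)
qed

lemma syndrome_coefficients:
  assumes "x \<in> D" "J \<subseteq> {1..L}" and zero: "\<And>i. i \<in> {1..L} - J \<Longrightarrow> x (3 * i - 1) = 0 \<and> x (3 * i) = 0"
  shows "(\<Sum>i\<in>{1..L}. contribution x i) = (\<Sum>i\<in>J. x (3 * i - 1) *s u i 1 + x (3 * i) *s u i 2)"
  unfolding contribution_def
  by (rule sum.mono_neutral_right) (use assms(2) zero in simp_all)

text \<open>The syndrome map from \<open>D\<close> is onto already on words supported in the first
  two triples, so its kernel has \<open>q ^ (2 * L) / q ^ 4\<close> elements.\<close>

lemma card_code:
  assumes "2 \<le> L"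
  shows "card code = CARD('a) ^ (2 * L - 4)"
proof -
  let ?f = "\<lambda>x. \<Sum>i\<in>{1..L}. contribution x i"
  have "y \<in> ?f ` D" for y
  proof -
    obtain a b where ab: "(\<Sum>i\<in>{1,2}. a i *s u i 1 + b i *s u i 2) = y"
      by (rule two_planes_generate[OF assms])
    obtain x where x: "x \<in> D" "\<And>i. i \<in> {1..L} \<Longrightarrow> x (3 * i - 1) = (if i \<in> {1,2} then a i else 0)"
      "\<And>i. i \<in> {1..L} \<Longrightarrow> x (3 * i) = (if i \<in> {1,2} then b i else 0)"
      by (rule word_with_coefficients[of "\<lambda>i. if i \<in> {1,2} then a i else 0" "\<lambda>i. if i \<in> {1,2} then b i else 0"]) blast
    have sub: "{1,2} \<subseteq> {1..L}"
      using assms by auto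
    have "?f x = (\<Sum>i\<in>{1,2}. x (3 * i - 1) *s u i 1 + x (3 * i) *s u i 2)"
    proof (rule syndrome_coefficients[OF x(1) sub])
      fix i assume "i \<in> {1..L} - {1,2}"
      then show "x (3 * i - 1) = 0 \<and> x (3 * i) = 0"
        using x(2)[of i] x(3)[of i] by simp
    qed
    also have "\<dots> = (\<Sum>i\<in>{1,2}. a i *s u i 1 + b i *s u i 2)"
    proof (rule sum.cong)
      fix i assume i: "i \<in> {1, 2 :: nat}"
      then have "i \<in> {1..L}"
        using sub by blast
      then show "x (3 * i - 1) *s u i 1 + x (3 * i) *s u i 2 = a i *s u i 1 + b i *s u i 2"
        using x(2)[of i] x(3)[of i] i by presburger
    qed simp
    finally have "?f x = y"
      by (rule trans) (rule ab)
    then show ?thesis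
      using x(1) by blast
  qed
  then have "?f ` D = UNIV"
    by blast
  then have "card (?f ` D) = CARD('a) ^ 4"
    by simp
  moreover have "card D = card {x \<in> D. ?f x = 0} * card (?f ` D)"
    by (rule card_kernel_image[OF finite_D word.subspace_diff[OF subspace_D] word.subspace_add[OF subspace_D]])
      (simp_all add: contribution_add sum.distrib)
  moreover have "CARD('a) ^ (2 * L) = CARD('a) ^ (2 * L - 4) * CARD('a) ^ 4"
    using assms by (simp flip: power_add)
  ultimately have "card code * CARD('a) ^ 4 = CARD('a) ^ (2 * L - 4) * CARD('a) ^ 4"
    unfolding card_D code_def by presburger
  then show ?thesis
    by simp
qed

section \<open>Weights of the words of the code\<close>

lemma block_sub: "i \<in> {1..L} \<Longrightarrow> block i \<subseteq> {1..3 * L}"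
  using Union_blocks[of L] by blast

lemma weight_eq_sum: "weight (3 * L) x = (\<Sum>i\<in>{1..L}. card {j \<in> block i. x j \<noteq> 0})"
proof -
  have "{j \<in> {1..3 * L}. x j \<noteq> 0} = (\<Union>i\<in>{1..L}. {j \<in> block i. x j \<noteq> 0})"
    unfolding Union_blocks[symmetric] by blast
  then show ?thesis
    unfolding weight_def
  proof (simp only:, intro card_UN_disjoint)
    show "\<forall>i\<in>{1..L}. \<forall>j\<in>{1..L}. i \<noteq> j \<longrightarrow> {k \<in> block i. x k \<noteq> 0} \<inter> {k \<in> block j. x k \<noteq> 0} = {}"
    proof (intro ballI impI)
      fix i j assume "i \<in> {1..L}" "j \<in> {1..L}" "i \<noteq> j"
      then have "block i \<inter> block j = {}"
        by (intro block_disjoint) auto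
      then show "{k \<in> block i. x k \<noteq> 0} \<inter> {k \<in> block j. x k \<noteq> 0} = {}"
        by blast
    qed
  qed (simp_all add: finite_block)
qed

text \<open>The zero sum rules out weight one. In weight two the entries are opposite, so the
  contribution is a multiple of the difference of two columns, which is one of the three chosen
  vectors up to sign.\<close>

lemma contribution_cases:
  assumes x: "x \<in> D" and i: "i \<in> {1..L}" and nz: "contribution x i \<noteq> 0"
  shows "3 \<le> card {j \<in> block i. x j \<noteq> 0} \<or>
    card {j \<in> block i. x j \<noteq> 0} = 2 \<and> (\<exists>\<alpha>. \<exists>a\<in>{0,1,2}. \<alpha> \<noteq> 0 \<and> contribution x i = \<alpha> *s u i a)"
proof -
  define p q r where "p = 3 * i - 2" and "q = 3 * i - 1" and "r = 3 * i"
  have "1 \<le> i"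
    using i by simp
  have sum0: "x p + (x q + x r) = 0"
    using D_sum[OF x i] by (simp add: p_def q_def r_def)
  have ne: "p \<noteq> q" "p \<noteq> r" "q \<noteq> r"
    using \<open>1 \<le> i\<close> unfolding p_def q_def r_def by linarith+
  have grp: "block i = {p, q, r}"
    by (simp add: block_def p_def q_def r_def)
  have contr: "contribution x i = x q *s u i 1 + x r *s u i 2"
    by (simp add: contribution_def q_def r_def)
  have u0: "u i 0 = u i 1 - u i 2"
    by (rule round(2)[OF i])
  consider "x q = 0" "x r = 0" | "x q = 0" "x r \<noteq> 0" | "x q \<noteq> 0" "x r = 0"
    | "x q \<noteq> 0" "x r \<noteq> 0" "x p = 0" | "x q \<noteq> 0" "x r \<noteq> 0" "x p \<noteq> 0"
    by blast
  then show ?thesis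
  proof cases
    case 1
    then show ?thesis
      using nz contr by simp
  next
    case 2
    then have "x p \<noteq> 0"
      using sum0 by auto
    then have "{j \<in> block i. x j \<noteq> 0} = {p, r}"
      using 2 by (auto simp: grp)
    moreover have "contribution x i = x r *s u i 2"
      using 2 contr by simp
    ultimately show ?thesis
      using ne 2 by auto
  next
    case 3
    then have "x p \<noteq> 0"
      using sum0 by auto
    then have "{j \<in> block i. x j \<noteq> 0} = {p, q}"
      using 3 by (auto simp: grp)
    moreover have "contribution x i = x q *s u i 1"
      using 3 contr by simp
    ultimately show ?thesis
      using ne 3 by auto
  next
    case 4
    then have "x r = - x q"
      using sum0 by (simp add: eq_neg_iff_add_eq_0 add.commute)
    then have "contribution x i = x q *s u i 0"
      unfolding contr u0 by (simp add: vec.scale_right_diff_distrib)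
    moreover have "{j \<in> block i. x j \<noteq> 0} = {q, r}"
      using 4 by (auto simp: grp)
    ultimately show ?thesis
      using ne 4 by auto
  next
    case 5
    then have "{j \<in> block i. x j \<noteq> 0} = {p, q, r}"
      by (auto simp: grp)
    then show ?thesis
      using ne by simp
  qed
qed

lemma contribution_in_plane: "contribution x i \<in> plane i"
  unfolding contribution_def plane_def by (intro vec.span_add vec.span_scale vec.span_base) simp_all

lemma contribution_zero:
  assumes "x \<in> D" "i \<in> {1..L}" "contribution x i = 0" "j \<in> block i"
  shows "x j = 0"
proof -
  have "x (3 * i - 1) = 0 \<and> x (3 * i) = 0"
    by (rule u_independent[OF assms(2)]) (use assms(3) in \<open>simp add: contribution_def\<close>)
  then show ?thesis
    using D_sum[OF assms(1,2)] assms(4) unfolding block_def by auto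
qed

lemma weight_code:
  assumes x: "x \<in> code" and "x \<noteq> 0"
  shows "7 \<le> weight (3 * L) x"
proof (rule ccontr)
  assume "\<not> 7 \<le> weight (3 * L) x"
  define s where "s = contribution x"
  define wt where "wt = (\<lambda>i. card {j \<in> block i. x j \<noteq> 0})"
  define I where "I = {i \<in> {1..L}. s i \<noteq> 0}"
  have xD: "x \<in> D" and sum0: "(\<Sum>i\<in>{1..L}. s i) = 0"
    using x by (auto simp: code_def s_def)
  have finI: "finite I" and I_sub: "I \<subseteq> {1..L}"
    by (auto simp: I_def)
  have cases: "3 \<le> wt i \<or> wt i = 2 \<and> (\<exists>\<alpha>. \<exists>a\<in>{0,1,2}. \<alpha> \<noteq> 0 \<and> s i = \<alpha> *s u i a)" if "i \<in> I" for i
    unfolding wt_def s_def by (rule contribution_cases[OF xD]) (use that in \<open>simp_all add: I_def s_def\<close>)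
  have sumI: "(\<Sum>i\<in>I. s i) = 0"
  proof -
    have "(\<Sum>i\<in>I. s i) = (\<Sum>i\<in>{1..L}. s i)"
      by (rule sum.mono_neutral_left) (use I_sub in \<open>auto simp: I_def\<close>)
    then show ?thesis
      using sum0 by simp
  qed
  have "(\<Sum>i\<in>I. wt i) \<le> (\<Sum>i\<in>{1..L}. wt i)"
    by (rule sum_mono2) (use I_sub in simp_all)
  then have wtI: "(\<Sum>i\<in>I. wt i) \<le> 6"
    using \<open>\<not> 7 \<le> weight (3 * L) x\<close> by (simp add: weight_eq_sum wt_def)
  \<comment> \<open>Every triple with nonzero contribution has weight at least two, so weight six
    allows at most three of them.\<close>
  have "card I * 2 \<le> (\<Sum>i\<in>I. wt i)"
    using sum_bounded_below[of I 2 wt] cases by fastforce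
  then have "card I \<le> 3"
    using wtI by linarith
  then consider "card I = 0" | "card I = 1" | "card I = 2" | "card I = 3"
    by linarith
  then show False
  proof cases
    case 1
    then have "I = {}"
      using finI by simp
    then have "s i = 0" if "i \<in> {1..L}" for i
      using that unfolding I_def by blast
    then have "x j = 0" if "i \<in> {1..L}" "j \<in> block i" for i j
      using contribution_zero[OF xD that(1) _ that(2)] that(1) unfolding s_def by blast
    then have "x j = 0" if "j \<in> {1..3 * L}" for j
      using that unfolding Union_blocks[symmetric] by blast
    then have "x j = 0" for j
      using D_outside[OF xD] by blast
    then show False
      using \<open>x \<noteq> 0\<close> by (simp add: fun_eq_iff)
  next
    case 2
    then obtain i where "I = {i}"
      by (auto simp: card_1_singleton_iff)
    then have "s i = 0" "i \<in> I"
      using sumI by simp_all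
    then show False
      by (simp add: I_def)
  next
    case 3
    \<comment> \<open>Two triples: whatever their weights, their contributions lie in two spread
      elements that meet only in 0.\<close>
    then obtain i j where ij: "I = {i, j}" "i \<noteq> j"
      by (auto simp: card_2_iff)
    then have "s i + s j = 0"
      using sumI by simp
    then have "s i = - s j"
      by (simp add: eq_neg_iff_add_eq_0)
    moreover have "- s j \<in> plane j"
      using contribution_in_plane[of x j] unfolding s_def plane_def by (rule vec.span_neg)
    moreover have "s i \<in> plane i"
      unfolding s_def by (rule contribution_in_plane)
    moreover have mem: "i \<in> {1..L}" "j \<in> {1..L}" "s i \<noteq> 0"
      using ij unfolding I_def by blast+
    ultimately have "s i \<in> plane i \<inter> plane j"
      by simp
    then show False
      using plane_inter[OF mem(1,2) ij(2)] mem(3) by blast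
  next
    case 4
    have "I \<noteq> {}"
      using 4 by auto
    \<comment> \<open>The latest of the three rounds; its vectors were chosen after the spans of
      points from the two earlier rounds had been removed.\<close>
    define l where "l = Max I"
    have l: "l \<in> I"
      unfolding l_def using finI \<open>I \<noteq> {}\<close> by (rule Max_in)
    have "card (I - {l}) = 2"
      using 4 l by simp
    then obtain i j where ij: "I - {l} = {i, j}" "i \<noteq> j"
      by (auto simp: card_2_iff)
    then have mem: "i \<in> I" "j \<in> I" "i \<noteq> l" "j \<noteq> l"
      by blast+
    then have less: "i < l" "j < l"
      using Max_ge[OF finI, of i] Max_ge[OF finI, of j] unfolding l_def by linarith+
    have I: "I = {i, j, l}"
      using ij l by blast
    \<comment> \<open>Three weights of at least two with sum at most six all equal two, so each
      contribution is a multiple of a single chosen vector.\<close>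
    have "wt i + wt j + wt l \<le> 6"
      using wtI ij(2) less unfolding I by simp
    then have "\<not> 3 \<le> wt i" "\<not> 3 \<le> wt j" "\<not> 3 \<le> wt l"
      using cases[OF mem(1)] cases[OF mem(2)] cases[OF l] by linarith+
    then obtain \<alpha> a \<beta> b \<gamma> c where
      a: "a \<in> {0,1,2}" "s i = \<alpha> *s u i a" and b: "b \<in> {0,1,2}" "s j = \<beta> *s u j b"
      and c: "c \<in> {0,1,2}" "\<gamma> \<noteq> 0" "s l = \<gamma> *s u l c"
      using cases[OF mem(1)] cases[OF mem(2)] cases[OF l] by blast
    have "s i + (s j + s l) = 0"
      using sumI ij(2) less unfolding I by simp
    then have "\<gamma> *s u l c = - (\<alpha> *s u i a + \<beta> *s u j b)"
      unfolding a(2) b(2) c(3) eq_neg_iff_add_eq_0 by (simp only: add_ac)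
    moreover have "- (\<alpha> *s u i a + \<beta> *s u j b) \<in> vec.span {u i a, u j b}"
      by (intro vec.span_neg vec.span_add vec.span_scale vec.span_base) simp_all
    ultimately have "\<gamma> *s u l c \<in> vec.span {u i a, u j b}"
      by (simp only:)
    from vec.span_scale[OF this, of "inverse \<gamma>"] have "u l c \<in> vec.span {u i a, u j b}"
      using c(2) by simp
    moreover have "u l c \<notin> vec.span {u i a, u j b}"
      by (rule u_not_in_span) (use mem l I_sub less ij(2) a b c in blast)+
    ultimately show False
      by blast
  qed
qed

text \<open>The four vectors of rounds 1 and 2 span the space, so they express \<open>u 3 1\<close>;
  this relation involves all six coordinates of two triples at most and two coordinates of the
  third.\<close>

lemma exists_word_of_weight_le_8:
  assumes "3 \<le> L"
  obtains x where "x \<in> code" "x \<noteq> 0" "weight (3 * L) x \<le> 8"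
proof -
  obtain a b where ab: "(\<Sum>i\<in>{1,2}. a i *s u i 1 + b i *s u i 2) = u 3 1"
    by (rule two_planes_generate[of "u 3 1"]) (use assms in simp_all)
  \<comment> \<open>The coefficient \<open>-1\<close> at \<open>i = 3\<close> cancels
    \<open>u 3 1\<close> and makes coordinate 8 nonzero; \<open>b' 3 = 0\<close> makes coordinate 9
    vanish.\<close>
  define a' b' where "a' = (\<lambda>i::nat. if i \<in> {1,2} then a i else if i = 3 then - 1 else 0)"
    and "b' = (\<lambda>i::nat. if i \<in> {1,2} then b i else 0)"
  obtain x where x: "x \<in> D" "\<And>i. i \<in> {1..L} \<Longrightarrow> x (3 * i - 2) = - a' i - b' i"
    "\<And>i. i \<in> {1..L} \<Longrightarrow> x (3 * i - 1) = a' i" "\<And>i. i \<in> {1..L} \<Longrightarrow> x (3 * i) = b' i"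
    by (rule word_with_coefficients[of a' b']) blast
  have sub: "{1,2,3} \<subseteq> {1..L}"
    using assms by auto
  have zero: "a' i = 0" "b' i = 0" if "i \<notin> {1,2,3}" for i
    using that by (simp_all add: a'_def b'_def)
  have "(\<Sum>i\<in>{1..L}. contribution x i) = (\<Sum>i\<in>{1,2,3}. x (3 * i - 1) *s u i 1 + x (3 * i) *s u i 2)"
  proof (rule syndrome_coefficients[OF x(1) sub])
    fix i assume "i \<in> {1..L} - {1,2,3}"
    then show "x (3 * i - 1) = 0 \<and> x (3 * i) = 0"
      using x(3)[of i] x(4)[of i] zero[of i] by simp
  qed
  also have "\<dots> = (\<Sum>i\<in>{1,2,3}. a' i *s u i 1 + b' i *s u i 2)"
  proof (rule sum.cong)
    fix i assume "i \<in> {1,2,3 :: nat}"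
    then have "i \<in> {1..L}"
      using sub by blast
    then show "x (3 * i - 1) *s u i 1 + x (3 * i) *s u i 2 = a' i *s u i 1 + b' i *s u i 2"
      using x(3)[of i] x(4)[of i] by presburger
  qed simp
  also have "\<dots> = (\<Sum>i\<in>{1,2}. a i *s u i 1 + b i *s u i 2) - u 3 1"
    by (simp add: a'_def b'_def)
  finally have "x \<in> code"
    using x(1) ab by (simp add: code_def)
  moreover have "x 8 = - 1"
    using x(3)[of 3] assms by (simp add: a'_def)
  then have "x \<noteq> 0"
    by force
  moreover have "weight (3 * L) x \<le> card {1..8::nat}"
  proof (rule weight_le_card)
    fix j assume j: "j \<in> {1..3 * L}" "j \<notin> {1..8}"
    then obtain i where i: "i \<in> {1..L}" "j \<in> block i"
      unfolding Union_blocks[symmetric] by blast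
    show "x j = 0"
    proof (cases "i \<in> {1,2,3}")
      case True
      then have "j = 9" "i = 3"
        using i(2) j by (auto simp: block_def)
      then show ?thesis
        using x(4)[OF i(1)] by (simp add: b'_def)
    next
      case False
      then show ?thesis
        using i(2) x(2-4)[OF i(1)] zero[OF False] unfolding block_def by auto
    qed
  qed simp
  then have "weight (3 * L) x \<le> 8"
    by simp
  ultimately show ?thesis
    by (rule that)
qed

text \<open>For distance 7 the packing requires differences in \<open>Z\<close> to be supported on
  at most two coordinates, as \<open>2 + 4 < 7\<close>. Hence \<open>Z\<close> is the line of the
  \<open>q\<close> words on coordinates 2 and 3 of the first triple with opposite entries.\<close>

lemma rounds_upper_bound:
  assumes "2 \<le> L"
  shows "(3 * L - 3) * (CARD('a) - 1) + CARD('a) \<le> CARD('a) ^ 3"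
proof -
  let ?q = "CARD('a)"
  define line :: "'a \<Rightarrow> nat \<Rightarrow> 'a" where
    "line = (\<lambda>\<beta> j. if j = 2 then \<beta> else if j = 3 then - \<beta> else 0)"
  have "inj line"
  proof (rule injI)
    fix \<beta> \<gamma> assume "line \<beta> = line \<gamma>"
    from fun_cong[OF this, of 2] show "\<beta> = \<gamma>"
      by (simp add: line_def)
  qed
  then have cZ: "card (range line) = ?q"
    by (simp add: card_image)
  have block1: "block 1 = {1, 2, 3}"
    by (auto simp: block_def)
  have "card code * ((3 * L - 3) * (?q - 1) * card (range line) + ?q\<^sup>2) \<le> card D"
    unfolding D_def
  proof (rule packing_bound[OF partition_blocks])
    show "card G = 3" if "G \<in> block ` {1..L}" for G
      using that card_block by auto
    show "code \<subseteq> parity_words {1..3 * L} (block ` {1..L}) (\<lambda>_. 1)"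
      unfolding code_def D_def by blast
    show "block 1 \<in> block ` {1..L}"
      using assms by simp
    show "range line \<subseteq> parity_words (block 1) {block 1} (\<lambda>_. 1)"
      unfolding block1 by (auto simp: parity_words_def line_def)
    show "\<exists>T. card T + 4 < 7 \<and> finite T \<and> {i. (y - z) i \<noteq> 0} \<subseteq> T" if "y \<in> range line" "z \<in> range line" for y z
      by (rule exI[of _ "{2,3}"]) (use that in \<open>auto simp: line_def split: if_splits\<close>)
  qed (use subspace_code weight_code in simp_all)
  then have "?q ^ (2 * L - 4) * ((3 * L - 3) * (?q - 1) * ?q + ?q\<^sup>2) \<le> ?q ^ (2 * L)"
    by (simp only: card_code[OF assms] cZ card_D)
  also have "?q ^ (2 * L) = ?q ^ (2 * L - 4) * ?q ^ 4"
    using assms by (simp flip: power_add)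
  finally have "(3 * L - 3) * (?q - 1) * ?q + ?q\<^sup>2 \<le> ?q ^ 4"
    using CARD_field_ge_2[where 'a='a] by simp
  moreover have "(3 * L - 3) * (?q - 1) * ?q + ?q\<^sup>2 = ((3 * L - 3) * (?q - 1) + ?q) * ?q"
    by (simp only: add_mult_distrib power2_eq_square)
  moreover have "?q ^ 4 = ?q ^ 3 * ?q"
    by (simp add: power_numeral_reduce)
  ultimately have "((3 * L - 3) * (?q - 1) + ?q) * ?q \<le> ?q ^ 3 * ?q"
    by presburger
  then show ?thesis
    using CARD_field_ge_2[where 'a='a] unfolding mult_le_cancel2 by linarith
qed

lemma repair_set_block:
  assumes i: "i \<in> {1..L}" and j: "j \<in> block i"
  shows "repair_set (3 * L) 2 code j (block i - {j})"
  unfolding repair_set_def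
proof (intro conjI exI[of _ "\<lambda>_. - 1"])
  show "block i - {j} \<subseteq> {1..3 * L} - {j}"
    using block_sub[OF i] by blast
  show "card (block i - {j}) \<le> 2"
    using card_block[of i] i j by simp
  show "\<forall>c\<in>code. c j = (\<Sum>k\<in>block i - {j}. - 1 * c k)"
  proof
    fix c assume "c \<in> code"
    then have "(\<Sum>k\<in>block i. c k) = 0"
      using D_sum[of c i] sum_block[of i c] i by (simp add: code_def)
    then have "c j + (\<Sum>k\<in>block i - {j}. c k) = 0"
      using sum.remove[OF finite_block j, of c] by simp
    then show "c j = (\<Sum>k\<in>block i - {j}. - 1 * c k)"
      by (simp add: sum_negf eq_neg_iff_add_eq_0)
  qed
qed simp

lemma disjoint_repair_groups_code: "disjoint_repair_groups (3 * L) 2 code"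
  unfolding disjoint_repair_groups_def
proof (intro exI[of _ "block ` {1..L}"] conjI ballI)
  show "partition_on {1..3 * L} (block ` {1..L})"
    by (rule partition_blocks)
  fix G assume "G \<in> block ` {1..L}"
  then obtain i where i: "i \<in> {1..L}" "G = block i"
    by blast
  then show "card G = 2 + 1"
    by (simp add: card_block)
  have mem: "3 * i \<in> block i"
    by (simp add: block_def)
  then have "3 * i \<in> {1..3 * L}" "G = insert (3 * i) (block i - {3 * i})"
    using block_sub[OF i(1)] i(2) by blast+
  then show "repair_group (3 * L) 2 code G"
    unfolding repair_group_def using repair_set_block[OF i(1) mem] by blast
qed

lemma lrc_code:
  assumes "3 \<le> L"
  obtains d where "d \<in> {7, 8}" "lrc (3 * L) (2 * L - 4) d 2 code"
proof -
  obtain x where x: "x \<in> code" "x \<noteq> 0" "weight (3 * L) x \<le> 8"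
    by (rule exists_word_of_weight_le_8[OF assms])
  then have ne: "code \<noteq> {0}"
    by blast
  have "min_dist (3 * L) code \<le> 8"
    using min_dist_le_weight[OF code_words subspace_code x(1,2)] x(3) by linarith
  moreover have "7 \<le> min_dist (3 * L) code"
    by (rule min_dist_geI[OF code_words subspace_code ne weight_code])
  ultimately have "min_dist (3 * L) code \<in> {7, 8}"
    by auto
  moreover have "CARD('a) ^ word.dim code = CARD('a) ^ (2 * L - 4)"
    using card_linear_code[OF code_words subspace_code] card_code assms by simp
  then have "word.dim code = 2 * L - 4"
    by (rule power_inject_exp[THEN iffD1, rotated]) (use CARD_field_ge_2[where 'a='a] in linarith)
  moreover have "\<exists>R. repair_set (3 * L) 2 code j R" if "j \<in> {1..3 * L}" for j
    using that repair_set_block unfolding Union_blocks[symmetric] by blast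
  ultimately show ?thesis
    using that code_words subspace_code ne unfolding lrc_def linear_code_def by blast
qed

end

section \<open>Numerical consequences of the bounds on the number of rounds\<close>

text \<open>For \<open>L \<le> 2\<close> the right-hand side is at most 22, whereas
  \<open>q \<ge> 4\<close> makes the left-hand side at least 34.\<close>

lemma rounds_ge_3:
  fixes L q :: nat
  assumes "4 \<le> q" "2 * (q\<^sup>2 + 1) \<le> 2 * L + 9 * (L * (L - 1))"
  shows "3 \<le> L"
proof (rule ccontr)
  assume "\<not> 3 \<le> L"
  then have "L = 0 \<or> L = 1 \<or> L = 2"
    by linarith
  moreover have "4\<^sup>2 \<le> q\<^sup>2"
    using assms(1) by (rule power_mono) simp
  ultimately show False
    using assms(2) by auto
qed

lemma rounds_quadratic:
  fixes L q :: nat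
  assumes "1 \<le> L" "2 * (q\<^sup>2 + 1) \<le> 2 * L + 9 * (L * (L - 1))"
  shows "2 * (real q)\<^sup>2 + 2 \<le> 9 * (real L)\<^sup>2 - 7 * real L"
proof -
  have "real (2 * (q\<^sup>2 + 1)) \<le> real (2 * L + 9 * (L * (L - 1)))"
    using assms(2) by (simp only: of_nat_le_iff)
  also have "\<dots> = 9 * (real L)\<^sup>2 - 7 * real L"
    using assms(1) by (simp add: of_nat_diff power2_eq_square algebra_simps)
  finally show ?thesis
    by simp
qed

text \<open>The leading terms give \<open>2 * q ^ 2 \<le> 9 * L ^ 2\<close>, the origin of
  \<open>sqrt 2 / 3\<close>.\<close>

lemma rounds_ge_sqrt:
  fixes L q :: nat
  assumes "2 * (real q)\<^sup>2 + 2 \<le> 9 * (real L)\<^sup>2 - 7 * real L"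
  shows "sqrt 2 / 3 * real q \<le> real L"
proof (rule power2_le_imp_le)
  have "(sqrt 2 / 3 * real q)\<^sup>2 = 2 / 9 * (real q)\<^sup>2"
    by (simp add: power_mult_distrib power_divide)
  also have "\<dots> \<le> (real L)\<^sup>2"
    using assms by simp
  finally show "(sqrt 2 / 3 * real q)\<^sup>2 \<le> (real L)\<^sup>2" .
qed simp

text \<open>Provides the length needed for the logarithm to exceed 3. If
  \<open>3 * L \<le> q + 3\<close>, then three times the quadratic inequality yields
  \<open>3 * q ^ 2 \<le> 11 * q\<close>, impossible for \<open>q \<ge> 4\<close>.\<close>

lemma rounds_gt_third:
  fixes L q :: nat
  assumes "4 \<le> q" "3 \<le> L" and le: "2 * (real q)\<^sup>2 + 2 \<le> 9 * (real L)\<^sup>2 - 7 * real L"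
  shows "q + 4 \<le> 3 * L"
proof (rule ccontr)
  assume "\<not> q + 4 \<le> 3 * L"
  then have x: "3 * real L \<le> real q + 3"
    by linarith
  have "(3 * real L) * (9 * real L - 7) \<le> (real q + 3) * (9 * real L - 7)"
    using x by (rule mult_right_mono) (use assms(2) in simp)
  also have "\<dots> \<le> (real q + 3) * (3 * real q + 2)"
    by (rule mult_left_mono) (use x in simp_all)
  finally have "27 * (real L)\<^sup>2 - 21 * real L \<le> 3 * (real q)\<^sup>2 + 11 * real q + 6"
    by (simp add: power2_eq_square algebra_simps)
  then have "3 * (real q)\<^sup>2 \<le> 11 * real q"
    using le by linarith
  moreover have "4 * real q \<le> real q * real q"
    by (rule mult_right_mono) (use assms(1) in simp_all)
  ultimately show False
    using assms(1) by (simp add: power2_eq_square)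
qed

text \<open>The argument of the logarithm equals \<open>q * ((n - 3) * (q - 1) + q)\<close>. The
  packing bound therefore says that it is at most \<open>q ^ 4\<close>, and
  \<open>n \<ge> q + 4\<close> makes the second factor at least \<open>q ^ 2 + q - 1\<close>, so the
  argument exceeds \<open>q ^ 3\<close>.\<close>

lemma ceiling_log_eq_4:
  fixes q n :: nat
  assumes "4 \<le> q" "q + 4 \<le> n" and upper: "(n - 3) * (q - 1) + q \<le> q ^ 3"
  shows "\<lceil>log (real q) (real q + (real q - 1) * real q * (real n - 2))\<rceil> = 4"
proof -
  define X where "X = real q + (real q - 1) * real q * (real n - 2)"
  have q: "1 < real q" "0 < real q"
    using assms(1) by simp_all
  have X_eq: "X = ((real n - 3) * (real q - 1) + real q) * real q"
    by (simp add: X_def algebra_simps)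
  have "real ((n - 3) * (q - 1) + q) \<le> real (q ^ 3)"
    using upper by (simp only: of_nat_le_iff)
  then have "(real n - 3) * (real q - 1) + real q \<le> real q ^ 3"
    using assms(1,2) by (simp add: of_nat_diff)
  then have "X \<le> real q ^ 3 * real q"
    unfolding X_eq by (rule mult_right_mono) simp
  then have le: "X \<le> real q ^ 4"
    by (simp add: power_numeral_reduce mult_ac)
  have "(real q + 1) * (real q - 1) \<le> (real n - 3) * (real q - 1)"
    by (rule mult_right_mono) (use assms q in simp_all)
  then have "(real q)\<^sup>2 < (real n - 3) * (real q - 1) + real q"
    using q(1) by (simp add: power2_eq_square algebra_simps)
  then have "(real q)\<^sup>2 * real q < X"
    unfolding X_eq using q(2) by (rule mult_strict_right_mono)
  then have gt: "real q ^ 3 < X"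
    by (simp add: power2_eq_square power3_eq_cube)
  have "0 < X"
    using gt q(2) by (meson less_trans zero_less_power)
  then have "log (real q) X \<le> 4" "3 < log (real q) X"
    using le gt q(1) by (simp_all add: log_le_iff less_log_iff)
  then show ?thesis
    unfolding X_def[symmetric] by (simp add: ceiling_eq_iff)
qed

lemma algorithm_terminates:
  assumes "algorithm_run u M"
  obtains S L where "finished_algorithm S u M L"
proof -
  obtain S where S: "two_spread S" "M 0 = one_dim_subspaces ` S"
    using assms unfolding algorithm_run_def by blast
  interpret algorithm S u M
  proof
    show "\<exists>A\<in>M (i - 1). admissible_choice A (u i) \<and> M i = trim u i (M (i - 1) - {A})"
      if "1 \<le> i" "\<And>j. j < i \<Longrightarrow> M j \<noteq> {}" for i
      using assms that unfolding algorithm_run_def by blast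
  qed (fact S)+
  define L where "L = (LEAST L. M L = {})"
  have "finished_algorithm S u M L"
  proof
    show "M L = {}"
      unfolding L_def using terminates by (rule LeastI_ex)
    show "M i \<noteq> {}" if "i < L" for i
      using not_less_Least[of i "\<lambda>L. M L = {}"] that unfolding L_def by blast
  qed
  then show ?thesis
    by (rule that)
qed

theorem theorem2:
  fixes u :: "nat \<Rightarrow> nat \<Rightarrow> 'a::{field,finite} ^ 4"
    and M :: "nat \<Rightarrow> ('a ^ 4) set set set"
    and q :: nat
  assumes "q = CARD('a)" and "q \<ge> 4"
    and "algorithm_run u M"
  shows "\<exists>L U. algorithm_output u M L U \<and>
    int L \<ge> max \<lceil>sqrt 2 / 3 * real q\<rceil> 3 \<and>
    (\<exists>n k d (C :: (nat \<Rightarrow> 'a) set).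
       lrc n k d 2 C \<and> disjoint_repair_groups n 2 C \<and>
       n = 3 * L \<and> int n \<ge> max (3 * \<lceil>sqrt 2 / 3 * real q\<rceil>) 9 \<and>
       int k = 2 * int L - 4 \<and> d \<in> {7, 8} \<and>
       real k = 2 * real n / 3
         - real_of_int \<lceil>log (real q) (real q + (real q - 1) * real q * (real n - 2))\<rceil> \<and>
       (n > q + 4 \<longrightarrow>
          d = 7 \<and> almost_optimal n k d 2 \<and>
          (\<forall>d' (C' :: (nat \<Rightarrow> 'a) set). lrc n k d' 2 C' \<longrightarrow> d' \<le> 7)))"
proof -
  obtain S L where "finished_algorithm S u M L"
    by (rule algorithm_terminates[OF assms(3)])
  then interpret finished_algorithm S u M L .
  have lower: "2 * (q\<^sup>2 + 1) \<le> 2 * L + 9 * (L * (L - 1))"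
    unfolding assms(1) by (rule rounds_lower_bound)
  have L3: "3 \<le> L"
    by (rule rounds_ge_3[OF assms(2) lower])
  have quad: "2 * (real q)\<^sup>2 + 2 \<le> 9 * (real L)\<^sup>2 - 7 * real L"
    by (rule rounds_quadratic[OF _ lower]) (use L3 in simp)
  have ceil: "\<lceil>sqrt 2 / 3 * real q\<rceil> \<le> int L"
    using rounds_ge_sqrt[OF quad] by (simp add: ceiling_le_iff)
  have third: "q + 4 \<le> 3 * L"
    by (rule rounds_gt_third[OF assms(2) L3 quad])
  have upper: "(3 * L - 3) * (q - 1) + q \<le> q ^ 3"
    unfolding assms(1) by (rule rounds_upper_bound) (use L3 in simp)
  obtain d where d: "d \<in> {7, 8}" "lrc (3 * L) (2 * L - 4) d 2 code"
    by (rule lrc_code[OF L3])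
  have run_output: "algorithm_output u M L (\<Union>i\<in>{1..L}. {u i 1, u i 2})"
    unfolding algorithm_output_def using finished running by blast
  have optimal: "d' \<le> 7" if "q + 4 < 3 * L" "lrc (3 * L) (2 * L - 4) d' 2 C'" for d' and C' :: "(nat \<Rightarrow> 'a) set"
    by (rule lrc_distance_le_7[OF that(2) L3]) (use that(1) assms(1) in simp)
  have dim: "real (2 * L - 4) = 2 * real (3 * L) / 3 - real_of_int
      \<lceil>log (real q) (real q + (real q - 1) * real q * (real (3 * L) - 2))\<rceil>"
    unfolding ceiling_log_eq_4[OF assms(2) third upper] using L3 by (simp add: of_nat_diff)
  \<comment> \<open>Here \<open>k / 2 = L - 2\<close> is an integer, and
    \<open>3 * L - (2 * L - 4) - (L - 2) + 1 = 7\<close>.\<close>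
  have almost: "almost_optimal (3 * L) (2 * L - 4) 7 2"
  proof -
    have "real (2 * L - 4) / real 2 = real_of_int (int L - 2)"
      using L3 by (simp add: of_nat_diff field_simps)
    then have "\<lceil>real (2 * L - 4) / real 2\<rceil> = int L - 2"
      by (simp only: ceiling_of_int)
    then show ?thesis
      unfolding almost_optimal_def using L3 by (simp add: of_nat_diff)
  qed
  \<comment> \<open>The bound on competing codes, applied to the constructed code itself, excludes
    distance 8.\<close>
  have large: "d = 7 \<and> almost_optimal (3 * L) (2 * L - 4) d 2" if "q + 4 < 3 * L"
    using optimal[OF that d(2)] d(1) almost by auto
  show ?thesis
  proof (intro exI conjI impI allI)
    show "algorithm_output u M L (\<Union>i\<in>{1..L}. {u i 1, u i 2})"
      by (rule run_output)
    show "lrc (3 * L) (2 * L - 4) d 2 code" "d \<in> {7, 8}"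
      by (fact d)+
    show "disjoint_repair_groups (3 * L) 2 code"
      by (rule disjoint_repair_groups_code)
    show "max \<lceil>sqrt 2 / 3 * real q\<rceil> 3 \<le> int L"
      using ceil L3 by simp
    show "max (3 * \<lceil>sqrt 2 / 3 * real q\<rceil>) 9 \<le> int (3 * L)"
      using ceil L3 by simp
    show "int (2 * L - 4) = 2 * int L - 4"
      using L3 by simp
    show "real (2 * L - 4) = 2 * real (3 * L) / 3 - real_of_int
        \<lceil>log (real q) (real q + (real q - 1) * real q * (real (3 * L) - 2))\<rceil>"
      by (rule dim)
    show "3 * L = 3 * L" ..
    show "d = 7" "almost_optimal (3 * L) (2 * L - 4) d 2" if "q + 4 < 3 * L"
      using large[OF that] by blast+
    show "d' \<le> 7" if "q + 4 < 3 * L" "lrc (3 * L) (2 * L - 4) d' 2 C'" for d' and C' :: "(nat \<Rightarrow> 'a) set"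
      by (rule optimal[OF that])
  qed
qed

end
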